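(* Let $\theta_1,\ldots,\theta_m>0$, $\bar\theta=\sum_{l=1}^m\theta_l$, and let $\Theta$ be the $m\times m$ matrix with $\Theta(i,j)=\theta_j$ for $i\ne j$ and $\Theta(i,i)=\theta_i-\bar\theta$. Then $$\mu_\Theta=\mathrm{Dir}(\theta_1,\ldots,\theta_m).$$
   Context: Let $\Sigma=\{1,\ldots,m\}$ with $m\ge 2$. $\mathbb{G}$ is the set of real $m\times m$ matrices $G$ with $G(i,j)>0$ for all distinct $i,j$ and $G(i,i)=-\sum_{j\ne i}G(i,j)$; note $\Theta\in\mathbb{G}$. For $G\in\mathbb{G}$, put $n(G)=\lceil\max_i|G(i,i)|\rceil$, $P^G_n=I$ for $1\le n\le n(G)$ and $P^G_n=I+G/n$ for $n\ge n(G)+1$. Let $(X_n)_{n\ge0}$ be the time-nonhomogeneous Markov chain on $\Sigma$ with some initial distribution $\pi$ and transition matrix $P^G_{n+1}$ between times $n$ and $n+1$, and let $\mathbf{Z}_n=\langle Z_{1,n},\ldots,Z_{m,n}\rangle$, $Z_{i,n}=\frac1n\sum_{k=1}^n1_i(X_k)$, with values in the simplex $\Delta_m=\{\mathbf{x}\in[0,1]^m:\sum_i x_i=1\}$. Then $\mu_G$ denotes the probability measure on $\Delta_m$ which is the limit in distribution of $\mathbf{Z}_n$ (it exists and does not depend on $\pi$). It is characterized by its moments: $E_{\mu_G}(x_i)=\nu_G(i)$ and, for integers $\gamma_1,\ldots,\gamma_m\ge0$ with $\bar\gamma=\sum_i\gamma_i\ge2$, $$E_{\mu_G}(x_1^{\gamma_1}\cdots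 x_m^{\gamma_m})=\frac1{\bar\gamma}\sum_{\sigma\in\mathbb{S}(\gamma_1,\ldots,\gamma_m)}\nu_G(\sigma_1)\prod_{i=1}^{\bar\gamma-1}(iI-G)^{-1}(\sigma_i,\sigma_{i+1}),$$ where $\nu_G$ is the unique left eigenvector of $G$ for eigenvalue $0$ with positive entries summing to $1$, and $\mathbb{S}(\gamma_1,\ldots,\gamma_m)$ is the collection of all $\bar\gamma!$ permutations (with multiplicity) of the list with $\gamma_k$ copies of $k$ for each $1\le k\le m$. $\mathrm{Dir}(\theta_1,\ldots,\theta_m)$ is the Dirichlet distribution on $\Delta_m$, with density $\frac{\Gamma(\bar\theta)}{\Gamma(\theta_1)\cdots\Gamma(\theta_m)}x_1^{\theta_1-1}\cdots x_m^{\theta_m-1}$ (with respect to Lebesgue measure in the first $m-1$ coordinates). *)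

theory Defs
  imports "HOL-Probability.Probability"
begin

text \<open>
  The state space is a finite linearly ordered type \<open>'m\<close>, in the role of the set
  \<open>{1, ..., m}\<close> with \<open>m = CARD('m)\<close>. The order only serves to single out the last coordinate.
\<close>

definition prob_simplex :: "(real ^ 'm) set" where
  "prob_simplex = {x. (\<forall>i. 0 \<le> x $ i \<and> x $ i \<le> 1) \<and> (\<Sum>i\<in>UNIV. x $ i) = 1}"

definition generators :: "(real ^ 'm ^ 'm) set" where
  "generators = {G. (\<forall>i j. i \<noteq> j \<longrightarrow> G $ i $ j > 0) \<and>
                    (\<forall>i. G $ i $ i = - (\<Sum>j\<in>UNIV - {i}. G $ i $ j))}"

definition start_index :: "real ^ 'm ^ 'm \<Rightarrow> nat" where
  "start_index G = nat \<lceil>Max (range (\<lambda>i. \<bar>G $ i $ i\<bar>))\<rceil>"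

definition trans_mat :: "real ^ 'm ^ 'm \<Rightarrow> nat \<Rightarrow> real ^ 'm ^ 'm" where
  "trans_mat G n = (if n \<le> start_index G then mat 1 else mat 1 + (1 / real n) *\<^sub>R G)"

text \<open>
  \<open>P (Suc n)\<close> is the transition matrix between times \<open>n\<close> and \<open>Suc n\<close>. Histories of
  probability \<open>0\<close> are excluded, since there the conditional probability is the junk value \<open>0\<close>.
\<close>

definition markov_chain ::
  "'a measure \<Rightarrow> (nat \<Rightarrow> 'a \<Rightarrow> 'm) \<Rightarrow> 'm pmf \<Rightarrow> (nat \<Rightarrow> real ^ 'm ^ 'm) \<Rightarrow> bool" where
  "markov_chain M X \<pi> P \<longleftrightarrow>
     prob_space M \<and>
     (\<forall>n. X n \<in> M \<rightarrow>\<^sub>M count_space UNIV) \<and>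
     (\<forall>i. \<P>(\<omega> in M. X 0 \<omega> = i) = pmf \<pi> i) \<and>
     (\<forall>n x j. \<P>(\<omega> in M. \<forall>k\<le>n. X k \<omega> = x k) \<noteq> 0 \<longrightarrow>
        \<P>(\<omega> in M. X (Suc n) \<omega> = j \<bar> \<forall>k\<le>n. X k \<omega> = x k) = P (Suc n) $ x n $ j)"

definition occupation :: "(nat \<Rightarrow> 'a \<Rightarrow> 'm) \<Rightarrow> nat \<Rightarrow> 'a \<Rightarrow> real ^ 'm" where
  "occupation X n \<omega> = (\<chi> i. (\<Sum>k=1..n. indicator {i} (X k \<omega>)) / real n)"

definition weakly_converges :: "(nat \<Rightarrow> ('b::topological_space) measure) \<Rightarrow> 'b measure \<Rightarrow> bool" where
  "weakly_converges N \<mu> \<longleftrightarrow>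
     (\<forall>f :: 'b \<Rightarrow> real. continuous_on UNIV f \<and> bounded (range f) \<longrightarrow>
        (\<lambda>n. integral\<^sup>L (N n) f) \<longlonglongrightarrow> integral\<^sup>L \<mu> f)"

text \<open>
  Measures on the simplex are rendered as Borel measures on the ambient space that give the
  simplex full mass. The underlying probability space ranges over all measures on the path type
  \<open>nat \<Rightarrow> 'm\<close>. A definition has to fix some type here, and this one is large enough to carry
  every such chain up to its law (as coordinate process), on which alone the laws of the
  occupation vectors depend.
\<close>

definition occupation_limit :: "real ^ ('m::finite) ^ 'm \<Rightarrow> (real ^ 'm) measure \<Rightarrow> bool" where
  "occupation_limit G \<mu> \<longleftrightarrow>
     prob_space \<mu> \<and> sets \<mu> = sets borel \<and> measure \<mu> prob_simplex = 1 \<and>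
     (\<forall>\<pi> (M :: (nat \<Rightarrow> 'm) measure) X. markov_chain M X \<pi> (trans_mat G) \<longrightarrow>
        weakly_converges (\<lambda>n. distr M borel (occupation X n)) \<mu>)"

text \<open>
  Only meaningful for \<open>G \<in> generators\<close>. Weak limits are unique, so any equation determining
  \<open>mu G\<close> requires showing that the limit exists and is the same for all initial distributions.
\<close>

definition mu :: "real ^ ('m::finite) ^ 'm \<Rightarrow> (real ^ 'm) measure" where
  "mu G = (THE \<mu>. occupation_limit G \<mu>)"

abbreviation last_index :: "'m::{finite,linorder}" where
  "last_index \<equiv> Max UNIV"

definition complete_coords :: "('m::{finite,linorder} \<Rightarrow> real) \<Rightarrow> real ^ ('m::_)" where
  "complete_coords y =
     (\<chi> i. if i = last_index then 1 - (\<Sum>j\<in>UNIV - {last_index}. y j) else y i)"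

definition dirichlet_density :: "real ^ ('m::finite) \<Rightarrow> real ^ 'm \<Rightarrow> real" where
  "dirichlet_density \<theta> x =
     (if x \<in> prob_simplex
      then Gamma (\<Sum>i\<in>UNIV. \<theta> $ i) / (\<Prod>i\<in>UNIV. Gamma (\<theta> $ i)) *
           (\<Prod>i\<in>UNIV. (x $ i) powr (\<theta> $ i - 1))
      else 0)"

text \<open>
  The density is taken with respect to Lebesgue measure in all coordinates but the last, and the
  result is transported to the simplex by \<open>complete_coords\<close>.
\<close>

definition dirichlet :: "real ^ ('m::{finite,linorder}) \<Rightarrow> (real ^ ('m::_)) measure" where
  "dirichlet \<theta> =
     distr (density (\<Pi>\<^sub>M i\<in>UNIV - {last_index}. lborel)
                    (\<lambda>y. ennreal (dirichlet_density \<theta> (complete_coords y))))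
           borel complete_coords"

definition Theta :: "real ^ 'm \<Rightarrow> real ^ 'm ^ 'm" where
  "Theta \<theta> = (\<chi> i j. if i = j then \<theta> $ i - (\<Sum>l\<in>UNIV. \<theta> $ l) else \<theta> $ j)"

lemma Theta_in_generators:
  fixes \<theta> :: "real ^ ('m::finite)"
  assumes "\<And>i. \<theta> $ i > 0"
  shows "Theta \<theta> \<in> generators"
proof -
  have "(\<Sum>j\<in>UNIV - {i}. Theta \<theta> $ i $ j) = (\<Sum>l\<in>UNIV. \<theta> $ l) - \<theta> $ i" for i
  proof -
    have "(\<Sum>j\<in>UNIV - {i}. Theta \<theta> $ i $ j) = (\<Sum>j\<in>UNIV - {i}. \<theta> $ j)"
      by (rule sum.cong) (auto simp: Theta_def)
    then show ?thesis
      by (simp add: sum_diff1)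
  qed
  then show ?thesis
    using assms by (auto simp: generators_def Theta_def)
qed

lemma complete_coords_measurable:
  "complete_coords \<in> (\<Pi>\<^sub>M i\<in>UNIV - {last_index}. lborel) \<rightarrow>\<^sub>M
     (borel :: (real ^ 'm::{finite,linorder}) measure)"
proof (rule borel_measurable_euclidean_space[THEN iffD2], rule ballI)
  fix b :: "real ^ ('m::_)" assume "b \<in> Basis"
  then obtain i where b: "b = axis i 1" by (auto simp: Basis_vec_def)
  show "(\<lambda>y. complete_coords y \<bullet> b) \<in> borel_measurable (\<Pi>\<^sub>M i\<in>UNIV - {last_index}. lborel)"
    by (cases "i = last_index") (simp_all add: b inner_axis complete_coords_def)
qed

end

theory Submission
  imports Defs "HOL-Real_Asymp.Real_Asymp"
begin

text \<open>
  The proof is by the method of moments. Write \<open>m\<^sub>n(A, j) = E[Z\<^sub>n^A; X\<^sub>n = j]\<close> for a multi-index \<open>A\<close>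
  and \<open>M\<^sub>n(A)\<close> for its sum over \<open>j\<close>. Since \<open>Z\<close> moves by \<open>(e\<^sub>j - Z) / (n + 1)\<close> when the chain jumps to
  \<open>j\<close>, one step of the chain gives, up to \<open>O(1/n)\<close> and with \<open>s\<close> the sum of the \<open>\<theta>\<^sub>j\<close>,
  \<open>(n + 1) (m\<^sub>n\<^sub>+\<^sub>1(A, j) - m\<^sub>n(A, j)) + (|A| + s) m\<^sub>n(A, j) = A\<^sub>j m\<^sub>n(A - e\<^sub>j, j) + \<theta>\<^sub>j M\<^sub>n(A)\<close>.
  A sequence with \<open>(n + 1) (a\<^sub>n\<^sub>+\<^sub>1 - a\<^sub>n) + c a\<^sub>n \<rightarrow> b\<close> and \<open>c > 0\<close> converges to \<open>b / c\<close>, so by induction on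
  \<open>|A|\<close> one gets \<open>M\<^sub>n(A) \<rightarrow> D(A)\<close> and \<open>m\<^sub>n(A, j) \<rightarrow> D(A + e\<^sub>j)\<close>, where \<open>D\<close> is determined by
  \<open>D(0) = 1\<close> and \<open>(s + |A|) D(A + e\<^sub>j) = (\<theta>\<^sub>j + A\<^sub>j) D(A)\<close>. These are the Dirichlet moments. In the limit,
  the state is thus distributed according to \<open>Z\<close> given \<open>Z\<close>. On the compact simplex, convergence of
  moments is weak convergence by Stone--Weierstrass.
\<close>

subsection \<open>An averaging recursion\<close>

text \<open>With \<open>t = 1 / (n + 1)\<close> the hypothesis reads
  \<open>a (Suc n) = (1 - c * t) * a n + t * d n\<close> with \<open>d\<close> tending to 0. The
  homogeneous recursion decays like \<open>n powr (- c)\<close>, and once \<open>d\<close> is below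
  \<open>c * e / 2\<close> the forcing cannot lift the absolute value of \<open>a\<close> above the
  level \<open>e / 2\<close>.\<close>

lemma recursion_tendsto_zero:
  fixes a :: "nat \<Rightarrow> real"
  assumes "c > 0" and d: "(\<lambda>n. (real n + 1) * (a (Suc n) - a n) + c * a n) \<longlonglongrightarrow> 0"
  shows "a \<longlonglongrightarrow> 0"
proof (rule LIMSEQ_I)
  fix e :: real assume "e > 0"
  define d where "d n = (real n + 1) * (a (Suc n) - a n) + c * a n" for n
  \<comment> \<open>The excess over \<open>e / 2\<close>. That level is the fixed point of sending
    \<open>x\<close> to \<open>(1 - c * t) * x + t * (c * e / 2)\<close>, so the excess obeys the
    homogeneous inequality.\<close>
  define h where "h n = max (\<bar>a n\<bar> - e / 2) 0" for n
  from LIMSEQ_D[OF d, of "c * e / 2"] \<open>c > 0\<close> \<open>e > 0\<close>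
  obtain N1 where N1: "\<And>n. n \<ge> N1 \<Longrightarrow> \<bar>d n\<bar> < c * e / 2"
    unfolding d_def by auto
  \<comment> \<open>The second bound gives \<open>c \<le> n\<close>, hence
    \<open>c * t \<le> 1\<close>, and the contraction factor \<open>1 - c * t\<close> is
    nonnegative.\<close>
  define N where "N = max N1 (nat \<lceil>c\<rceil>)"
  have h_step: "h (Suc n) * (real (Suc n) + 1) powr c \<le> h n * (real n + 1) powr c" if "n \<ge> N" for n
  proof -
    define t where "t = 1 / (real n + 1)"
    have t: "t > 0" "(real n + 1) * t = 1" by (auto simp: t_def)
    have "c \<le> real n" using that unfolding N_def by linarith
    then have ct: "c * t \<le> 1" by (simp add: t_def)
    have "(real n + 1) * (a (Suc n) - a n) = d n - c * a n" by (simp add: d_def)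
    then have "a (Suc n) - a n = t * (d n - c * a n)"
      by (simp add: t_def field_simps)
    then have "a (Suc n) = (1 - c * t) * a n + t * d n" by (simp add: algebra_simps)
    then have "\<bar>a (Suc n)\<bar> \<le> (1 - c * t) * \<bar>a n\<bar> + t * \<bar>d n\<bar>"
      using ct t(1) by (intro order_trans[OF eq_refl[OF arg_cong[of _ _ abs]] order_trans[OF abs_triangle_ineq]])
        (assumption | simp add: abs_mult)+
    also have "t * \<bar>d n\<bar> \<le> t * (c * e / 2)"
      using N1[of n] that t(1) by (intro mult_left_mono) (auto simp: N_def less_imp_le)
    finally have "\<bar>a (Suc n)\<bar> \<le> (1 - c * t) * \<bar>a n\<bar> + t * (c * e / 2)" by simp
    moreover have "(1 - c * t) * (\<bar>a n\<bar> - e / 2) = (1 - c * t) * \<bar>a n\<bar> + t * (c * e / 2) - e / 2"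
      by (simp add: field_simps)
    ultimately have "\<bar>a (Suc n)\<bar> - e / 2 \<le> (1 - c * t) * (\<bar>a n\<bar> - e / 2)"
      by linarith
    also have "\<dots> \<le> (1 - c * t) * h n"
      using ct by (intro mult_left_mono) (auto simp: h_def)
    finally have "h (Suc n) \<le> (1 - c * t) * h n"
      using ct by (auto simp: h_def)
    also have "\<dots> \<le> exp (- c * t) * h n"
      using exp_ge_add_one_self[of "- c * t"] by (intro mult_right_mono) (auto simp: h_def)
    finally have "h (Suc n) \<le> exp (- c * t) * h n" .
    \<comment> \<open>The weight grows by at most \<open>exp (c * t)\<close>, exactly what the
      contraction \<open>exp (- c * t)\<close> compensates; so \<open>h n\<close> times the weight
      is nonincreasing from \<open>N\<close> on.\<close>
    moreover have "(real (Suc n) + 1) powr c \<le> exp (c * t) * (real n + 1) powr c"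
    proof -
      have "real (Suc n) + 1 = (1 + t) * (real n + 1)"
        using t(2) by (simp add: algebra_simps)
      then have "(real (Suc n) + 1) powr c = (1 + t) powr c * (real n + 1) powr c"
        using t(1) by (simp add: powr_mult)
      moreover have "(1 + t) powr c \<le> exp (c * t)"
        using \<open>c > 0\<close> t(1) ln_add_one_self_le_self[of t] by (simp add: powr_def)
      ultimately show ?thesis by (simp only: mult_right_mono powr_ge_zero)
    qed
    ultimately have "h (Suc n) * (real (Suc n) + 1) powr c
        \<le> (exp (- c * t) * h n) * (exp (c * t) * (real n + 1) powr c)"
      by (intro mult_mono) (auto simp: h_def)
    also have "\<dots> = (exp (- c * t) * exp (c * t)) * (h n * (real n + 1) powr c)"
      by (simp only: ac_simps)
    also have "\<dots> = h n * (real n + 1) powr c"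
      by (simp add: exp_add[symmetric])
    finally show ?thesis .
  qed
  have le: "h n * (real n + 1) powr c \<le> h N * (real N + 1) powr c" if "n \<ge> N" for n
    using that
  proof (induction n rule: dec_induct)
    case (step n)
    then show ?case using h_step[of n] by linarith
  qed simp
  have "(\<lambda>n. h N * (real N + 1) powr c * (real n + 1) powr (- c)) \<longlonglongrightarrow> 0"
    using \<open>c > 0\<close> by real_asymp
  from LIMSEQ_D[OF this, of "e / 2"] \<open>e > 0\<close> obtain N2
    where N2: "\<And>n. n \<ge> N2 \<Longrightarrow> \<bar>h N * (real N + 1) powr c * (real n + 1) powr (- c)\<bar> < e / 2"
    by auto
  have "\<bar>a n\<bar> < e" if n: "n \<ge> max N N2" for n
  proof -
    have "h n = h n * (real n + 1) powr c * (real n + 1) powr (- c)"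
      by (simp add: powr_minus)
    also have "\<dots> \<le> h N * (real N + 1) powr c * (real n + 1) powr (- c)"
      using le[of n] n by (intro mult_right_mono) auto
    also have "\<dots> < e / 2" using N2[of n] n by simp
    finally show ?thesis unfolding h_def by linarith
  qed
  then show "\<exists>no. \<forall>n\<ge>no. norm (a n - 0) < e"
    by (intro exI[of _ "max N N2"]) simp
qed

text \<open>Shifting \<open>a\<close> by \<open>b / c\<close> preserves the increments and removes
  the limit \<open>b\<close> of the forcing.\<close>

lemma recursion_tendsto:
  fixes a :: "nat \<Rightarrow> real"
  assumes "c > 0" and d: "(\<lambda>n. (real n + 1) * (a (Suc n) - a n) + c * a n) \<longlonglongrightarrow> b"
  shows "a \<longlonglongrightarrow> b / c"
proof -
  have "(\<lambda>n. ((real n + 1) * (a (Suc n) - a n) + c * a n) - b) \<longlonglongrightarrow> b - b"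
    by (intro tendsto_diff d tendsto_const)
  also have "(\<lambda>n. ((real n + 1) * (a (Suc n) - a n) + c * a n) - b)
      = (\<lambda>n. (real n + 1) * ((a (Suc n) - b / c) - (a n - b / c)) + c * (a n - b / c))"
    using \<open>c > 0\<close> by (simp add: fun_eq_iff right_diff_distrib[of c])
  finally have "(\<lambda>n. a n - b / c) \<longlonglongrightarrow> 0"
    unfolding diff_self by (rule recursion_tendsto_zero[OF \<open>c > 0\<close>])
  then show ?thesis by (simp add: LIM_zero_iff)
qed

subsection \<open>Monomials on the simplex\<close>

text \<open>Multi-indices are encoded as multisets: \<open>count\<close> is the exponent,
  \<open>size\<close> the degree, \<open>add_mset j\<close> raises one exponent, and multiset
  induction is induction on the degree.\<close>

definition monomial :: "'m multiset \<Rightarrow> real ^ 'm \<Rightarrow> real" where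
  "monomial A z = (\<Prod>i\<in>#A. z $ i)"

lemma monomial_empty [simp]: "monomial {#} z = 1"
  by (simp add: monomial_def)

lemma monomial_add [simp]: "monomial (add_mset i A) z = z $ i * monomial A z"
  by (simp add: monomial_def)

lemma monomial_measurable [measurable]: "monomial A \<in> borel_measurable borel"
  by (induction A) (simp_all add: monomial_def borel_measurable_continuous_onI)

lemma prob_simplexD: "z \<in> prob_simplex \<Longrightarrow> 0 \<le> z $ i" "z \<in> prob_simplex \<Longrightarrow> z $ i \<le> 1"
  by (auto simp: prob_simplex_def)

lemma monomial_bounds:
  assumes "z \<in> prob_simplex"
  shows "0 \<le> monomial A z \<and> monomial A z \<le> 1"
  by (induction A) (auto intro!: mult_nonneg_nonneg mult_le_one simp: prob_simplexD[OF assms])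

text \<open>The derivative of \<open>monomial A\<close> at \<open>z\<close> in the direction \<open>axis j 1 - z\<close>.\<close>

definition monomial_drift :: "'m multiset \<Rightarrow> 'm \<Rightarrow> real ^ 'm \<Rightarrow> real" where
  "monomial_drift A j z =
     real (count A j) * monomial (A - {#j#}) z - real (size A) * monomial A z"

text \<open>The Leibniz rule for the product of the coordinate \<open>i\<close> with
  \<open>monomial A\<close>. The cases arise because \<open>A - {#j#}\<close> lowers an exponent
  only if \<open>j\<close> occurs in \<open>A\<close>; otherwise its coefficient
  \<open>count A j\<close> is 0.\<close>

lemma monomial_drift_add:
  "monomial_drift (add_mset i A) j z =
     (axis j 1 $ i - z $ i) * monomial A z + z $ i * monomial_drift A j z"
proof (cases "i = j")
  case True
  show ?thesis
  proof (cases "j \<in># A")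
    case True
    then have "monomial A z = z $ j * monomial (A - {#j#}) z"
      by (metis insert_DiffM monomial_add)
    then show ?thesis using \<open>i = j\<close>
      by (simp add: monomial_drift_def axis_def algebra_simps)
  next
    case False
    then have "count A j = 0" by (simp add: not_in_iff)
    then show ?thesis using \<open>i = j\<close>
      by (simp add: monomial_drift_def axis_def algebra_simps)
  qed
next
  case False
  show ?thesis
  proof (cases "j \<in># A")
    case True
    then have "add_mset i A - {#j#} = add_mset i (A - {#j#})" using False by simp
    then show ?thesis using False
      by (simp add: monomial_drift_def axis_def algebra_simps)
  next
    case not_in: False
    then have "count A j = 0" by (simp add: not_in_iff)
    then show ?thesis using False
      by (simp add: monomial_drift_def axis_def algebra_simps)
  qed
qed

text \<open>On the simplex the drift is a difference of two numbers between 0 and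
  \<open>size A\<close>.\<close>

lemma monomial_drift_bound:
  assumes "z \<in> prob_simplex"
  shows "\<bar>monomial_drift A j z\<bar> \<le> real (size A)"
proof -
  have "0 \<le> real (count A j) * monomial (A - {#j#}) z"
    using monomial_bounds[OF assms] by simp
  moreover have "real (count A j) * monomial (A - {#j#}) z \<le> real (size A) * 1"
    using monomial_bounds[OF assms] by (intro mult_mono) (auto simp: count_le_size)
  moreover have "0 \<le> real (size A) * monomial A z"
    using monomial_bounds[OF assms] by simp
  moreover have "real (size A) * monomial A z \<le> real (size A) * 1"
    using monomial_bounds[OF assms] by (intro mult_mono) auto
  ultimately show ?thesis by (simp add: monomial_drift_def)
qed

text \<open>Convexity of the simplex, with a vertex as one endpoint. For
  \<open>t = 1 / (n + 1)\<close> this is the move made by the occupation vector.\<close>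

lemma simplex_segment:
  assumes z: "z \<in> prob_simplex" and t: "0 \<le> t" "t \<le> 1"
  shows "z + t *\<^sub>R (axis j 1 - z) \<in> prob_simplex"
proof -
  have eq: "(z + t *\<^sub>R (axis j 1 - z)) $ i = (1 - t) * z $ i + t * axis j 1 $ i" for i
    by (simp add: algebra_simps)
  have b: "0 \<le> axis j (1::real) $ i" "axis j (1::real) $ i \<le> 1" for i
    by (auto simp: axis_def)
  have "(\<Sum>i\<in>UNIV. (1 - t) * z $ i + t * axis j 1 $ i) = (1 - t) * 1 + t * 1"
    using z by (simp add: sum.distrib sum_distrib_left[symmetric] prob_simplex_def axis_def
)
  moreover have "(1 - t) * z $ i + t * axis j 1 $ i \<le> (1 - t) * 1 + t * 1" for i
    using t b[of i] prob_simplexD[OF z] by (intro add_mono mult_left_mono) auto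
  moreover have "0 \<le> (1 - t) * z $ i + t * axis j 1 $ i" for i
    using t b[of i] prob_simplexD[OF z] by (intro add_nonneg_nonneg mult_nonneg_nonneg) auto
  ultimately show ?thesis unfolding prob_simplex_def mem_Collect_eq eq by simp
qed

text \<open>A first-order Taylor expansion whose quadratic remainder is uniform in the point, the
  direction and the step. Induction along the Leibniz rule gives the constant without second
  derivatives.\<close>

lemma monomial_segment_expansion:
  "\<exists>C\<ge>0. \<forall>z\<in>prob_simplex. \<forall>j t. 0 \<le> t \<and> t \<le> 1 \<longrightarrow>
     \<bar>monomial A (z + t *\<^sub>R (axis j 1 - z)) - monomial A z - t * monomial_drift A j z\<bar> \<le> C * t\<^sup>2"
proof (induction A)
  case empty
  show ?case by (intro exI[of _ 0]) (simp add: monomial_drift_def)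
next
  case (add i A)
  then obtain C where C: "C \<ge> 0" "\<And>z j t. z \<in> prob_simplex \<Longrightarrow> 0 \<le> t \<Longrightarrow> t \<le> 1 \<Longrightarrow>
     \<bar>monomial A (z + t *\<^sub>R (axis j 1 - z)) - monomial A z - t * monomial_drift A j z\<bar> \<le> C * t\<^sup>2"
    by blast
  show ?case
  proof (intro exI[of _ "real (size A) + C"] conjI ballI allI impI)
    fix z :: "real ^ 'a" and j and t :: real
    assume z: "z \<in> prob_simplex" and t: "0 \<le> t \<and> t \<le> 1"
    define z' where "z' = z + t *\<^sub>R (axis j 1 - z)"
    define u where "u = axis j 1 $ i - z $ i"
    define r where "r = monomial A z' - monomial A z - t * monomial_drift A j z"
    have z': "z' \<in> prob_simplex" unfolding z'_def using z t by (intro simplex_segment) auto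
    have z'i: "z' $ i = z $ i + t * u" by (simp add: z'_def u_def)
    have r: "\<bar>r\<bar> \<le> C * t\<^sup>2" unfolding r_def z'_def using C(2) z t by blast
    have u: "\<bar>u\<bar> \<le> 1" using prob_simplexD[OF z, of i] by (auto simp: u_def axis_def)
    \<comment> \<open>This is the remainder for \<open>add_mset i A\<close>: the product of the two
      first-order terms, at most \<open>size A\<close> times the square of \<open>t\<close>, plus
      the old remainder times a coordinate in the unit interval. Hence the new constant
      \<open>size A + C\<close>.\<close>
    have "\<bar>t\<^sup>2 * u * monomial_drift A j z + z' $ i * r\<bar>
        \<le> t\<^sup>2 * \<bar>u\<bar> * \<bar>monomial_drift A j z\<bar> + z' $ i * \<bar>r\<bar>"
      using prob_simplexD[OF z', of i]
      by (intro order_trans[OF abs_triangle_ineq]) (simp add: abs_mult)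
    also have "\<dots> \<le> t\<^sup>2 * 1 * real (size A) + 1 * (C * t\<^sup>2)"
      using prob_simplexD[OF z', of i] u r monomial_drift_bound[OF z, of A j] C(1)
      by (intro add_mono mult_mono) auto
    also have "t\<^sup>2 * u * monomial_drift A j z + z' $ i * r
        = monomial (add_mset i A) z' - monomial (add_mset i A) z
          - t * monomial_drift (add_mset i A) j z"
    proof -
      have "monomial A z' = r + monomial A z + t * monomial_drift A j z" by (simp add: r_def)
      then show ?thesis
        by (simp add: monomial_drift_add z'i u_def[symmetric]) (simp add: algebra_simps power2_eq_square)
    qed
    finally show "\<bar>monomial (add_mset i A) (z + t *\<^sub>R (axis j 1 - z)) - monomial (add_mset i A) z
          - t * monomial_drift (add_mset i A) j z\<bar> \<le> (real (size A) + C) * t\<^sup>2"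
      by (simp add: z'_def algebra_simps)
  qed (use C(1) in simp)
qed

subsection \<open>Moments of the Dirichlet distribution\<close>

text \<open>The substitution \<open>y = s * t\<close> reduces this to the Beta integral; the
  integrand contributes the power \<open>a + b - 2\<close> of \<open>s\<close> and the Jacobian one
  more.\<close>

lemma nn_integral_Beta_scaled:
  fixes a b s :: real
  assumes "a > 0" "b > 0" "s \<ge> 0"
  shows "(\<integral>\<^sup>+y. ennreal (indicator {0..s} y * (y powr (a - 1) * (s - y) powr (b - 1))) \<partial>lborel)
    = ennreal (s powr (a + b - 1) * Beta a b)"
proof (cases "s = 0")
  case True
  \<comment> \<open>\<open>0 powr x\<close> is 0 for every exponent \<open>x\<close>, so both sides
    vanish when \<open>s = 0\<close>.\<close>
  have "indicator {0..0} y * (y powr (a - 1) * (0 - y) powr (b - 1)) = 0" for y :: real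
    by (auto simp: indicator_def)
  then show ?thesis unfolding True by (simp only:) simp
next
  case False
  with assms have s: "s > 0" by simp
  have B: "Beta a b \<ge> 0" using assms by (simp add: Beta_def)
  have "((\<lambda>t. indicator {0..1} t * (t powr (a - 1) * (1 - t) powr (b - 1))) has_integral Beta a b) UNIV"
  proof -
    have "(\<lambda>t::real. indicator {0..1} t * (t powr (a - 1) * (1 - t) powr (b - 1)))
      = (\<lambda>t. if t \<in> {0..1} then t powr (a - 1) * (1 - t) powr (b - 1) else 0)"
      by (auto simp: indicator_def fun_eq_iff)
    then show ?thesis
      using has_integral_Beta_real[OF assms(1,2)] by (simp only: has_integral_restrict_UNIV)
  qed
  then have base: "(\<integral>\<^sup>+t. ennreal (indicator {0..1} t * (t powr (a - 1) * (1 - t) powr (b - 1))) \<partial>lborel)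
      = ennreal (Beta a b)"
    by (intro nn_integral_has_integral_lborel) auto
  have "(\<integral>\<^sup>+y. ennreal (indicator {0..s} y * (y powr (a - 1) * (s - y) powr (b - 1))) \<partial>lborel)
    = ennreal s * (\<integral>\<^sup>+t. ennreal (indicator {0..s} (0 + s * t) *
        ((0 + s * t) powr (a - 1) * (s - (0 + s * t)) powr (b - 1))) \<partial>lborel)"
    using s by (subst nn_integral_real_affine[where c = s and t = 0]) auto
  also have "(\<lambda>t. ennreal (indicator {0..s} (0 + s * t) *
        ((0 + s * t) powr (a - 1) * (s - (0 + s * t)) powr (b - 1))))
     = (\<lambda>t. ennreal (s powr (a + b - 2)) *
          ennreal (indicator {0..1} t * (t powr (a - 1) * (1 - t) powr (b - 1))))"
  proof
    fix t :: real
    show "ennreal (indicator {0..s} (0 + s * t) *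
        ((0 + s * t) powr (a - 1) * (s - (0 + s * t)) powr (b - 1)))
      = ennreal (s powr (a + b - 2)) *
          ennreal (indicator {0..1} t * (t powr (a - 1) * (1 - t) powr (b - 1)))"
    proof (cases "0 \<le> t \<and> t \<le> 1")
      case True
      have "s - s * t = s * (1 - t)" by (simp add: algebra_simps)
      then have "(s * t) powr (a - 1) * (s - s * t) powr (b - 1)
        = (s powr (a - 1) * s powr (b - 1)) * (t powr (a - 1) * (1 - t) powr (b - 1))"
        using True s by (simp add: powr_mult)
      also have "s powr (a - 1) * s powr (b - 1) = s powr (a + b - 2)"
        using s by (simp add: powr_add[symmetric])
      finally show ?thesis
        using True s by (simp add: ennreal_mult' mult_left_le)
    next
      case False
      then have "s * t \<notin> {0..s}" using s
        by (auto simp: zero_le_mult_iff)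
      then show ?thesis using False by (auto simp: indicator_def)
    qed
  qed
  also have "(\<integral>\<^sup>+t. ennreal (s powr (a + b - 2)) *
      ennreal (indicator {0..1} t * (t powr (a - 1) * (1 - t) powr (b - 1))) \<partial>lborel)
      = ennreal (s powr (a + b - 2)) * ennreal (Beta a b)"
    by (subst nn_integral_cmult) (auto simp: base)
  also have "ennreal s * (ennreal (s powr (a + b - 2)) * ennreal (Beta a b))
      = ennreal (s * s powr (a + b - 2) * Beta a b)"
    using s B by (simp add: ennreal_mult' mult.assoc)
  also have "s * s powr (a + b - 2) = s powr (a + b - 1)"
    using s by (simp add: powr_mult_base algebra_simps)
  finally show ?thesis .
qed

text \<open>Coordinates are integrated out one at a time. Fixing one of them at \<open>y\<close>
  leaves the same integral with total mass \<open>s - y\<close>, and the remaining integral over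
  \<open>y\<close> is a scaled Beta integral. Since \<open>y\<close> runs over the whole line,
  \<open>s\<close> must be arbitrary and may be negative, whence the conditional on the right. The
  exponent \<open>b\<close> belongs to the coordinate fixed by the total.\<close>

lemma nn_integral_Dirichlet:
  fixes a :: "'i \<Rightarrow> real" and b s :: real
  assumes "finite I" "\<And>i. i \<in> I \<Longrightarrow> a i > 0" "b > 0"
  shows "(\<integral>\<^sup>+x. ennreal (if (\<forall>i\<in>I. 0 \<le> x i) \<and> sum x I \<le> s
             then (\<Prod>i\<in>I. x i powr (a i - 1)) * (s - sum x I) powr (b - 1) else 0)
           \<partial>(\<Pi>\<^sub>M i\<in>I. lborel))
    = ennreal (if 0 \<le> s then s powr (sum a I + b - 1) *
        ((\<Prod>i\<in>I. Gamma (a i)) * Gamma b / Gamma (sum a I + b)) else 0)"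
  using assms(1,2)
proof (induction I arbitrary: s rule: finite_induct)
  case empty
  interpret product_sigma_finite "\<lambda>_::'i. lborel :: real measure" by standard
  have "Gamma b \<noteq> 0" using \<open>b > 0\<close> by (simp add: Gamma_eq_zero_iff nonpos_Ints_def)
  then show ?case by (subst nn_integral_empty) auto
next
  case (insert i I)
  interpret product_sigma_finite "\<lambda>_::'i. lborel :: real measure" by standard
  have [measurable]: "(\<lambda>x. sum x J) \<in> borel_measurable (\<Pi>\<^sub>M i\<in>J. lborel)" for J :: "'i set"
    by (rule borel_measurable_sum) measurable
  have [simp]: "finite (insert i I)" "finite I" using insert.hyps by auto
  let ?F = "\<lambda>J s x. if (\<forall>i\<in>J. 0 \<le> x i) \<and> sum x J \<le> s
     then (\<Prod>i\<in>J. x i powr (a i - 1)) * (s - sum x J) powr (b - 1) else (0::real)"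
  define K where "K = (\<Prod>i\<in>I. Gamma (a i)) * Gamma b / Gamma (sum a I + b)"
  have sum_pos: "0 < sum a I + b"
    using insert.prems \<open>b > 0\<close> by (intro add_nonneg_pos sum_nonneg) (auto simp: less_imp_le)
  have K: "K \<ge> 0" unfolding K_def using insert.prems \<open>b > 0\<close> sum_pos
    by (intro divide_nonneg_nonneg mult_nonneg_nonneg prod_nonneg) (auto intro: less_imp_le Gamma_real_pos)
  have ai: "a i > 0" using insert.prems by simp
  have meas: "(\<lambda>x. ennreal (?F (insert i I) s x)) \<in> borel_measurable (\<Pi>\<^sub>M i\<in>insert i I. lborel)"
    by measurable
  have meas': "(\<lambda>x. ennreal (?F I s' x)) \<in> borel_measurable (\<Pi>\<^sub>M i\<in>I. lborel)" for s'
    by measurable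
  \<comment> \<open>The constraint on the total becomes \<open>sum x I \<le> s - y\<close>, so the
    integrand is a power of \<open>y\<close> times the integrand for \<open>I\<close> at
    \<open>s - y\<close>.\<close>
  have split: "ennreal (?F (insert i I) s (x(i := y)))
      = ennreal (if 0 \<le> y then y powr (a i - 1) else 0) * ennreal (?F I (s - y) x)" for x y
  proof -
    have s: "sum (x(i := y)) I = sum x I" using insert.hyps by (intro sum.cong) auto
    have p: "(\<Prod>k\<in>I. (x(i := y)) k powr (a k - 1)) = (\<Prod>k\<in>I. x k powr (a k - 1))"
      using insert.hyps by (intro prod.cong) auto
    have S: "sum (x(i := y)) (insert i I) = y + sum x I" using insert.hyps s by simp
    have P: "(\<Prod>k\<in>insert i I. (x(i := y)) k powr (a k - 1))
        = y powr (a i - 1) * (\<Prod>k\<in>I. x k powr (a k - 1))"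
      using insert.hyps p by simp
    have q: "(\<forall>k\<in>insert i I. 0 \<le> (x(i := y)) k) \<longleftrightarrow> 0 \<le> y \<and> (\<forall>k\<in>I. 0 \<le> x k)"
      using insert.hyps by auto
    have "?F (insert i I) s (x(i := y))
        = (if 0 \<le> y then y powr (a i - 1) else 0) * ?F I (s - y) x"
      unfolding q S P by (auto simp: algebra_simps)
    then show ?thesis by (simp add: ennreal_mult')
  qed
  have "(\<integral>\<^sup>+x. ennreal (?F (insert i I) s x) \<partial>(\<Pi>\<^sub>M i\<in>insert i I. lborel))
    = (\<integral>\<^sup>+y. (\<integral>\<^sup>+x. ennreal (?F (insert i I) s (x(i := y))) \<partial>(\<Pi>\<^sub>M i\<in>I. lborel)) \<partial>lborel)"
    using insert.hyps meas by (rule product_nn_integral_insert_rev)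
  also have "\<dots> = (\<integral>\<^sup>+y. ennreal (if 0 \<le> y then y powr (a i - 1) else 0) *
      ennreal (if 0 \<le> s - y then (s - y) powr (sum a I + b - 1) * K else 0) \<partial>lborel)"
    unfolding split
    by (intro nn_integral_cong, subst nn_integral_cmult[OF meas'], subst insert.IH)
       (use insert.prems in \<open>auto simp: K_def\<close>)
  also have "\<dots> = (\<integral>\<^sup>+y. ennreal K *
      ennreal (indicator {0..s} y * (y powr (a i - 1) * (s - y) powr ((sum a I + b) - 1))) \<partial>lborel)"
    using K by (intro nn_integral_cong) (auto simp: indicator_def ennreal_mult'[symmetric] ac_simps)
  also have "\<dots> = ennreal K * (\<integral>\<^sup>+y.
      ennreal (indicator {0..s} y * (y powr (a i - 1) * (s - y) powr ((sum a I + b) - 1))) \<partial>lborel)"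
    by (intro nn_integral_cmult) auto
  also have "\<dots> = ennreal (if 0 \<le> s then s powr (sum a (insert i I) + b - 1) *
        ((\<Prod>i\<in>insert i I. Gamma (a i)) * Gamma b / Gamma (sum a (insert i I) + b)) else 0)"
  proof (cases "0 \<le> s")
    case True
    have G: "Gamma (sum a I + b) \<noteq> 0" using Gamma_real_pos[OF sum_pos] by simp
    \<comment> \<open>The factor \<open>Gamma (sum a I + b)\<close> cancels between the denominator
      of \<open>K\<close> and the numerator of the Beta function.\<close>
    have KB: "K * Beta (a i) (sum a I + b) =
       (\<Prod>i\<in>insert i I. Gamma (a i)) * Gamma b / Gamma (sum a (insert i I) + b)"
      using insert.hyps G by (simp add: K_def Beta_def add.assoc)
    have "a i + (sum a I + b) - 1 = sum a (insert i I) + b - 1"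
      using insert.hyps by simp
    then have "K * (s powr (a i + (sum a I + b) - 1) * Beta (a i) (sum a I + b)) =
        s powr (sum a (insert i I) + b - 1) *
          ((\<Prod>i\<in>insert i I. Gamma (a i)) * Gamma b / Gamma (sum a (insert i I) + b))"
      by (simp only: KB[symmetric] mult.left_commute)
    then show ?thesis
      using True by (simp only: nn_integral_Beta_scaled[OF ai sum_pos True] ennreal_mult'[OF K, symmetric] if_True)
  next
    case False
    then have "indicator {0..s} y = (0::real)" for y by (auto simp: indicator_def)
    then show ?thesis using False by simp
  qed
  finally show ?case .
qed

section \<open>The Dirichlet density and its normalising constant\<close>

lemma compact_prob_simplex: "compact (prob_simplex :: (real ^ 'm::finite) set)"
proof -
  have eq: "(prob_simplex :: (real ^ 'm) set)
    = cbox 0 1 \<inter> {x. (\<Sum>i\<in>UNIV. x $ i) = 1}"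
    by (auto simp: prob_simplex_def mem_box_cart)
  have "closed {x :: real ^ 'm. (\<Sum>i\<in>UNIV. x $ i) = 1}"
    by (intro closed_Collect_eq continuous_intros)
  then show ?thesis unfolding eq by (intro compact_Int_closed compact_cbox)
qed

lemma prob_simplex_borel [measurable]: "(prob_simplex :: (real ^ 'm::finite) set) \<in> sets borel"
  using compact_prob_simplex by (intro borel_closed compact_imp_closed)

text \<open>The reciprocal of the multivariate Beta function; Dirichlet moments are ratios of its
  values.\<close>

definition dirichlet_const :: "real ^ ('m::finite) \<Rightarrow> real" where
  "dirichlet_const \<theta> = Gamma (\<Sum>i\<in>UNIV. \<theta> $ i) / (\<Prod>i\<in>UNIV. Gamma (\<theta> $ i))"

text \<open>The parameter of the Dirichlet density obtained, up to normalisation, by multiplying the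
  density with \<open>monomial A\<close>.\<close>

definition multi_shift :: "real ^ 'm \<Rightarrow> 'm multiset \<Rightarrow> real ^ ('m::finite)" where
  "multi_shift \<theta> A = (\<chi> i. \<theta> $ i + real (count A i))"

lemma multi_shift_empty [simp]: "multi_shift \<theta> {#} = \<theta>"
  by (simp add: multi_shift_def)

lemma multi_shift_add: "multi_shift \<theta> (add_mset j A) = multi_shift \<theta> A + axis j 1"
  by (simp add: multi_shift_def vec_eq_iff axis_def)

lemma multi_shift_pos: "(\<And>i. \<theta> $ i > 0) \<Longrightarrow> multi_shift \<theta> A $ i > 0"
  by (simp add: multi_shift_def add_pos_nonneg)

lemma sum_multi_shift: "(\<Sum>i\<in>UNIV. multi_shift \<theta> A $ i) = (\<Sum>i\<in>UNIV. \<theta> $ i) + real (size A)"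
  by (induction A) (simp_all add: multi_shift_add sum.distrib axis_def)

lemma dirichlet_const_pos:
  fixes \<theta> :: "real ^ ('m::finite)"
  assumes "\<And>i. \<theta> $ i > 0"
  shows "dirichlet_const \<theta> > 0"
  unfolding dirichlet_const_def using assms
  by (intro divide_pos_pos prod_pos Gamma_real_pos sum_pos) auto

text \<open>The functional equation of \<open>Gamma\<close>, used once at the total in the numerator
  and once at the coordinate \<open>j\<close> in the denominator.\<close>

lemma dirichlet_const_axis:
  fixes \<theta> :: "real ^ ('m::finite)"
  assumes "\<And>i. \<theta> $ i > 0"
  shows "dirichlet_const (\<theta> + axis j 1) * \<theta> $ j = dirichlet_const \<theta> * (\<Sum>i\<in>UNIV. \<theta> $ i)"
proof -
  have pos: "(\<Sum>i\<in>UNIV. \<theta> $ i) > 0" using assms by (intro sum_pos) auto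
  have G: "Gamma (x + 1) = x * Gamma x" if "x > 0" for x :: real
    using that by (intro Gamma_plus1) (auto elim!: nonpos_Ints_cases)
  have s: "(\<Sum>i\<in>UNIV. (\<theta> + axis j 1) $ i) = (\<Sum>i\<in>UNIV. \<theta> $ i) + 1"
    by (simp add: sum.distrib axis_def)
  have p: "(\<Prod>i\<in>UNIV. Gamma ((\<theta> + axis j 1) $ i)) = \<theta> $ j * (\<Prod>i\<in>UNIV. Gamma (\<theta> $ i))"
  proof -
    have "(\<Prod>i\<in>UNIV. Gamma ((\<theta> + axis j 1) $ i))
        = Gamma (\<theta> $ j + 1) * (\<Prod>i\<in>UNIV - {j}. Gamma (\<theta> $ i))"
      by (subst prod.remove[of _ j]) (auto simp: axis_def intro!: prod.cong)
    also have "\<dots> = \<theta> $ j * (Gamma (\<theta> $ j) * (\<Prod>i\<in>UNIV - {j}. Gamma (\<theta> $ i)))"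
      using G[OF assms] by simp
    also have "Gamma (\<theta> $ j) * (\<Prod>i\<in>UNIV - {j}. Gamma (\<theta> $ i)) = (\<Prod>i\<in>UNIV. Gamma (\<theta> $ i))"
      by (rule prod.remove[symmetric]) auto
    finally show ?thesis .
  qed
  show ?thesis
    unfolding dirichlet_const_def s p G[OF pos] using assms[of j] by simp
qed

text \<open>Nonnegativity of the last coordinate is the bound on the sum, which together with
  nonnegativity bounds each free coordinate by 1. The right side is the region of integration of
  \<open>nn_integral_Dirichlet\<close> at \<open>s = 1\<close>.\<close>

lemma complete_coords_in_simplex_iff:
  fixes y :: "'m::{finite,linorder} \<Rightarrow> real"
  shows "complete_coords y \<in> prob_simplex \<longleftrightarrow>
    (\<forall>i\<in>UNIV - {last_index}. 0 \<le> y i) \<and> sum y (UNIV - {last_index}) \<le> 1"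
proof -
  let ?I = "UNIV - {last_index :: 'm}"
  have sum1: "(\<Sum>i\<in>UNIV. complete_coords y $ i) = 1"
    by (subst sum.remove[of _ last_index]) (auto simp: complete_coords_def)
  have le: "y i \<le> sum y ?I" if "\<forall>i\<in>?I. 0 \<le> y i" "i \<in> ?I" for i
    using that by (intro member_le_sum) auto
  show ?thesis
  proof
    assume "complete_coords y \<in> prob_simplex"
    then have nonneg: "0 \<le> complete_coords y $ i" for i by (simp add: prob_simplexD)
    have "0 \<le> y i" if "i \<in> ?I" for i using nonneg[of i] that by (simp add: complete_coords_def)
    moreover have "sum y ?I \<le> 1" using nonneg[of last_index] by (simp add: complete_coords_def)
    ultimately show "(\<forall>i\<in>?I. 0 \<le> y i) \<and> sum y ?I \<le> 1" by blast
  next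
    assume *: "(\<forall>i\<in>?I. 0 \<le> y i) \<and> sum y ?I \<le> 1"
    then have "0 \<le> sum y ?I" by (intro sum_nonneg) auto
    then show "complete_coords y \<in> prob_simplex"
      using * le sum1 unfolding prob_simplex_def
      by (auto simp: complete_coords_def intro: order_trans)
  qed
qed

lemma dirichlet_density_complete_coords:
  fixes y :: "'m::{finite,linorder} \<Rightarrow> real"
  shows "dirichlet_density \<theta> (complete_coords y) = dirichlet_const \<theta> *
    (if (\<forall>i\<in>UNIV - {last_index}. 0 \<le> y i) \<and> sum y (UNIV - {last_index}) \<le> 1
     then (\<Prod>i\<in>UNIV - {last_index}. y i powr (\<theta> $ i - 1)) *
       (1 - sum y (UNIV - {last_index})) powr (\<theta> $ last_index - 1) else 0)"
proof -
  have "(\<Prod>i\<in>UNIV. complete_coords y $ i powr (\<theta> $ i - 1))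
    = (\<Prod>i\<in>UNIV - {last_index}. y i powr (\<theta> $ i - 1)) *
       (1 - sum y (UNIV - {last_index})) powr (\<theta> $ last_index - 1)"
    by (subst prod.remove[of _ last_index]) (auto simp: complete_coords_def)
  then show ?thesis
    unfolding dirichlet_density_def complete_coords_in_simplex_iff dirichlet_const_def by simp
qed

lemma dirichlet_density_measurable [measurable]:
  "dirichlet_density \<theta> \<in> borel_measurable borel"
proof -
  have "(\<lambda>x :: real ^ 'a. x $ i) \<in> borel_measurable borel" for i
    by (intro borel_measurable_continuous_onI continuous_intros)
  then show ?thesis unfolding dirichlet_density_def by measurable
qed

lemma nn_integral_dirichlet_density:
  fixes \<theta> :: "real ^ 'm::{finite,linorder}"
  assumes "\<And>i. \<theta> $ i > 0"
  shows "(\<integral>\<^sup>+y. ennreal (dirichlet_density \<theta> (complete_coords y))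
    \<partial>(\<Pi>\<^sub>M i\<in>UNIV - {last_index}. lborel)) = 1"
proof -
  note [measurable] = complete_coords_measurable
  let ?I = "UNIV - {last_index :: 'm}"
  let ?F = "\<lambda>y. if (\<forall>i\<in>?I. 0 \<le> y i) \<and> sum y ?I \<le> 1
     then (\<Prod>i\<in>?I. y i powr (\<theta> $ i - 1)) * (1 - sum y ?I) powr (\<theta> $ last_index - 1) else (0::real)"
  have c: "dirichlet_const \<theta> > 0" using assms by (rule dirichlet_const_pos)
  \<comment> \<open>Measurability of \<open>?F\<close> is inherited from the density, of which it is
    a constant multiple.\<close>
  have F: "?F y = dirichlet_density \<theta> (complete_coords y) / dirichlet_const \<theta>" for y
    using c by (simp add: dirichlet_density_complete_coords)
  have [measurable]: "(\<lambda>y. ennreal (?F y)) \<in> borel_measurable (\<Pi>\<^sub>M i\<in>?I. lborel)"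
    unfolding F by measurable
  have s: "(\<Sum>i\<in>?I. \<theta> $ i) + \<theta> $ last_index = (\<Sum>i\<in>UNIV. \<theta> $ i)"
    by (subst (2) sum.remove[of _ last_index]) auto
  have p: "(\<Prod>i\<in>?I. Gamma (\<theta> $ i)) * Gamma (\<theta> $ last_index) = (\<Prod>i\<in>UNIV. Gamma (\<theta> $ i))"
    by (subst (2) prod.remove[of _ last_index]) auto
  have "(\<integral>\<^sup>+y. ennreal (dirichlet_density \<theta> (complete_coords y)) \<partial>(\<Pi>\<^sub>M i\<in>?I. lborel))
      = (\<integral>\<^sup>+y. ennreal (dirichlet_const \<theta>) * ennreal (?F y) \<partial>(\<Pi>\<^sub>M i\<in>?I. lborel))"
    unfolding dirichlet_density_complete_coords using c
    by (intro nn_integral_cong) (simp only: ennreal_mult'[OF less_imp_le])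
  also have "\<dots> = ennreal (dirichlet_const \<theta>) * (\<integral>\<^sup>+y. ennreal (?F y) \<partial>(\<Pi>\<^sub>M i\<in>?I. lborel))"
    by (rule nn_integral_cmult) measurable
  also have "(\<integral>\<^sup>+y. ennreal (?F y) \<partial>(\<Pi>\<^sub>M i\<in>?I. lborel))
      = ennreal ((\<Prod>i\<in>UNIV. Gamma (\<theta> $ i)) / Gamma (\<Sum>i\<in>UNIV. \<theta> $ i))"
    using nn_integral_Dirichlet[of ?I "($) \<theta>" "\<theta> $ last_index" 1] assms
    by (simp add: s p)
  also have "ennreal (dirichlet_const \<theta>) * \<dots> = 1"
  proof -
    have "(\<Sum>i\<in>UNIV. \<theta> $ i) > 0" "(\<Prod>i\<in>UNIV. Gamma (\<theta> $ i)) > 0"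
      using assms by (auto intro!: sum_pos prod_pos Gamma_real_pos)
    moreover from this have "Gamma (\<Sum>i\<in>UNIV. \<theta> $ i) > 0" by (intro Gamma_real_pos)
    moreover have aux: "a / b * (b / a) = 1" if "a > 0" "b > 0" for a b :: real
      using that by simp
    ultimately have one: "dirichlet_const \<theta> * ((\<Prod>i\<in>UNIV. Gamma (\<theta> $ i)) / Gamma (\<Sum>i\<in>UNIV. \<theta> $ i)) = 1"
      unfolding dirichlet_const_def by (intro aux)
    then show ?thesis unfolding ennreal_mult'[OF less_imp_le[OF c], symmetric] by (simp only: one ennreal_1)
  qed
  finally show ?thesis .
qed

lemma monomial_eq_prod:
  fixes z :: "real ^ 'm::finite"
  shows "monomial A z = (\<Prod>i\<in>UNIV. z $ i ^ count A i)"
proof -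
  have "monomial A z = (\<Prod>i\<in>set_mset A. z $ i ^ count A i)"
    unfolding monomial_def by (rule image_prod_mset_multiplicity)
  also have "\<dots> = (\<Prod>i\<in>UNIV. z $ i ^ count A i)"
    by (rule prod.mono_neutral_left) (auto simp: not_in_iff)
  finally show ?thesis .
qed

lemma dirichlet_density_times_monomial:
  fixes x :: "real ^ 'm::finite"
  assumes "\<And>i. \<theta> $ i > 0"
  shows "dirichlet_density \<theta> x * monomial A x =
    dirichlet_const \<theta> / dirichlet_const (multi_shift \<theta> A) * dirichlet_density (multi_shift \<theta> A) x"
proof (cases "x \<in> prob_simplex")
  case True
  have "(\<Prod>i\<in>UNIV. x $ i powr (\<theta> $ i - 1)) * monomial A x
      = (\<Prod>i\<in>UNIV. x $ i powr (multi_shift \<theta> A $ i - 1))"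
    unfolding monomial_eq_prod prod.distrib[symmetric]
  proof (rule prod.cong)
    fix i
    show "x $ i powr (\<theta> $ i - 1) * x $ i ^ count A i = x $ i powr (multi_shift \<theta> A $ i - 1)"
    \<comment> \<open>On the boundary both sides are 0, since \<open>powr\<close> with base 0 is 0
      whatever the exponent.\<close>
    proof (cases "x $ i = 0")
      case False
      then have "x $ i > 0" using prob_simplexD(1)[OF True, of i] by simp
      then show ?thesis
        by (simp add: multi_shift_def powr_realpow[symmetric] powr_add[symmetric] algebra_simps)
    qed simp
  qed simp
  moreover have "dirichlet_const (multi_shift \<theta> A) \<noteq> 0"
    using dirichlet_const_pos[OF multi_shift_pos[OF assms]] by (metis less_irrefl)
  ultimately show ?thesis using True
    by (simp add: dirichlet_density_def dirichlet_const_def[symmetric])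
next
  case False
  then show ?thesis by (simp add: dirichlet_density_def)
qed

lemma dirichlet_density_nonneg:
  assumes "\<And>i. \<theta> $ i > 0"
  shows "dirichlet_density \<theta> x \<ge> 0"
  unfolding dirichlet_density_def dirichlet_const_def[symmetric]
  using less_imp_le[OF dirichlet_const_pos[OF assms]]
  by (auto intro!: mult_nonneg_nonneg prod_nonneg)

section \<open>The Dirichlet law and its moments\<close>

lemma sets_dirichlet [simp]: "sets (dirichlet \<theta>) = sets borel"
  by (simp add: dirichlet_def)

lemma emeasure_dirichlet_simplex:
  fixes \<theta> :: "real ^ 'm::{finite,linorder}"
  assumes "\<And>i. \<theta> $ i > 0"
  shows "emeasure (dirichlet \<theta>) prob_simplex = 1"
proof -
  note [measurable] = complete_coords_measurable
  let ?P = "\<Pi>\<^sub>M i\<in>UNIV - {last_index :: 'm}. (lborel :: real measure)"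
  let ?S = "complete_coords -` prob_simplex \<inter> space ?P"
  have S: "?S \<in> sets ?P" by measurable
  have "emeasure (dirichlet \<theta>) prob_simplex
      = (\<integral>\<^sup>+y. ennreal (dirichlet_density \<theta> (complete_coords y)) * indicator ?S y \<partial>?P)"
    using S by (simp add: dirichlet_def emeasure_distr emeasure_density)
  also have "\<dots> = (\<integral>\<^sup>+y. ennreal (dirichlet_density \<theta> (complete_coords y)) \<partial>?P)"
    by (rule nn_integral_cong) (auto simp: indicator_def dirichlet_density_def)
  finally show ?thesis using nn_integral_dirichlet_density[OF assms] by simp
qed

lemma prob_space_dirichlet:
  fixes \<theta> :: "real ^ 'm::{finite,linorder}"
  assumes "\<And>i. \<theta> $ i > 0"
  shows "prob_space (dirichlet \<theta>)"
proof -
  note [measurable] = complete_coords_measurable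
  have "prob_space (density (\<Pi>\<^sub>M i\<in>UNIV - {last_index :: 'm}. lborel)
    (\<lambda>y. ennreal (dirichlet_density \<theta> (complete_coords y))))"
    by (intro prob_spaceI)
       (simp add: emeasure_density nn_integral_dirichlet_density[OF assms] cong: nn_integral_cong)
  then show ?thesis unfolding dirichlet_def by (intro prob_space.prob_space_distr) auto
qed

text \<open>Multiplying by the monomial gives a multiple of another Dirichlet density, and that
  density has total mass 1.\<close>

lemma dirichlet_moment:
  fixes \<theta> :: "real ^ 'm::{finite,linorder}"
  assumes "\<And>i. \<theta> $ i > 0"
  shows "integral\<^sup>L (dirichlet \<theta>) (monomial A)
    = dirichlet_const \<theta> / dirichlet_const (multi_shift \<theta> A)"
proof -
  note [measurable] = complete_coords_measurable
  let ?P = "\<Pi>\<^sub>M i\<in>UNIV - {last_index :: 'm}. (lborel :: real measure)"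
  define r where "r = dirichlet_const \<theta> / dirichlet_const (multi_shift \<theta> A)"
  note shift_pos = multi_shift_pos[OF assms]
  have r: "r \<ge> 0" unfolding r_def
    using dirichlet_const_pos[OF assms] dirichlet_const_pos[OF shift_pos]
    by (intro divide_nonneg_nonneg less_imp_le)
  have "integral\<^sup>L (dirichlet \<theta>) (monomial A)
    = (\<integral>y. dirichlet_density \<theta> (complete_coords y) * monomial A (complete_coords y) \<partial>?P)"
    unfolding dirichlet_def
    by (subst integral_distr) (auto simp: integral_density dirichlet_density_nonneg[OF assms])
  also have "\<dots> = r * (\<integral>y. dirichlet_density (multi_shift \<theta> A) (complete_coords y) \<partial>?P)"
    unfolding dirichlet_density_times_monomial[OF assms] r_def by simp
  also have "(\<integral>y. dirichlet_density (multi_shift \<theta> A) (complete_coords y) \<partial>?P) = 1"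
    by (subst integral_eq_nn_integral)
       (auto simp: nn_integral_dirichlet_density[OF shift_pos] dirichlet_density_nonneg[OF shift_pos])
  finally show ?thesis by (simp add: r_def)
qed

text \<open>\<open>dirichlet_const_axis\<close> at the shifted parameter. Together with the value 1
  at the empty multiset this recursion fixes all moments; it is the form in which they are matched
  with the chain.\<close>

lemma dirichlet_moment_add:
  fixes \<theta> :: "real ^ 'm::{finite,linorder}"
  assumes "\<And>i. \<theta> $ i > 0"
  shows "((\<Sum>i\<in>UNIV. \<theta> $ i) + real (size A)) * integral\<^sup>L (dirichlet \<theta>) (monomial (add_mset j A))
    = (\<theta> $ j + real (count A j)) * integral\<^sup>L (dirichlet \<theta>) (monomial A)"
proof -
  let ?t = "multi_shift \<theta> A"
  have p: "?t $ i > 0" for i by (rule multi_shift_pos[OF assms])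
  have "dirichlet_const (?t + axis j 1) * ?t $ j = dirichlet_const ?t * (\<Sum>i\<in>UNIV. ?t $ i)"
    by (rule dirichlet_const_axis[OF p])
  moreover have "dirichlet_const ?t > 0" by (rule dirichlet_const_pos[OF p])
  ultimately have "(\<Sum>i\<in>UNIV. ?t $ i) = dirichlet_const (?t + axis j 1) * ?t $ j / dirichlet_const ?t"
    by simp
  moreover have "dirichlet_const (?t + axis j 1) > 0"
    using multi_shift_pos[OF assms, of "add_mset j A"]
    unfolding multi_shift_add by (intro dirichlet_const_pos)
  moreover have "?t $ j = \<theta> $ j + real (count A j)" by (simp add: multi_shift_def)
  ultimately show ?thesis
    unfolding dirichlet_moment[OF assms] multi_shift_add sum_multi_shift by simp
qed

subsection \<open>Weak convergence on the simplex\<close>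

text \<open>Convergence of integrals passes through linear combinations but not through products, so
  polynomials are first rewritten as members of this linear span.\<close>

inductive monomial_span :: "(real ^ 'm \<Rightarrow> real) \<Rightarrow> bool" where
  monomial: "monomial_span (monomial A)"
| scale: "monomial_span f \<Longrightarrow> monomial_span (\<lambda>x. c * f x)"
| add: "monomial_span f \<Longrightarrow> monomial_span g \<Longrightarrow> monomial_span (\<lambda>x. f x + g x)"

lemma monomial_span_sum:
  assumes "finite I" "\<And>i. i \<in> I \<Longrightarrow> monomial_span (f i)"
  shows "monomial_span (\<lambda>x. \<Sum>i\<in>I. f i x)"
  using assms
proof (induction I rule: finite_induct)
  case empty
  show ?case using monomial_span.scale[OF monomial_span.monomial, of 0 "{#}"] by simp
next
  case (insert i I)
  then show ?case by (simp add: monomial_span.add)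
qed

lemma monomial_span_coord:
  assumes "monomial_span f"
  shows "monomial_span (\<lambda>x. x $ i * f x)"
  using assms
proof induction
  case (monomial A)
  have "monomial (add_mset i A) = (\<lambda>x. x $ i * monomial A x)" by (rule ext) simp
  then show ?case using monomial_span.monomial[of "add_mset i A"] by simp
next
  case (scale f c)
  then show ?case using monomial_span.scale[of "\<lambda>x. x $ i * f x" c] by (simp add: ac_simps)
next
  case (add f g)
  then show ?case using monomial_span.add by (simp add: distrib_left)
qed

text \<open>The induction proves that multiplication by \<open>p\<close> maps the span into itself.
  A product of polynomials then acts as two successive multiplications, and applying the result to
  the constant monomial recovers \<open>p\<close>.\<close>

lemma real_polynomial_function_monomial_span:
  fixes p :: "real ^ 'm::finite \<Rightarrow> real"
  assumes "real_polynomial_function p"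
  shows "monomial_span p"
proof -
  have "monomial_span f \<Longrightarrow> monomial_span (\<lambda>x. p x * f x)" for f
    using assms
  proof (induction arbitrary: f)
    case (linear h)
    have h: "h x = (\<Sum>i\<in>UNIV. h (axis i 1) * x $ i)" for x
    proof -
      have "h x = h (\<Sum>i\<in>UNIV. x $ i *\<^sub>R axis i 1)"
        by (simp add: basis_expansion scalar_mult_eq_scaleR[symmetric])
      also have "\<dots> = (\<Sum>i\<in>UNIV. h (axis i 1) * x $ i)"
        using linear.hyps by (simp add: linear_sum linear_scale bounded_linear.linear mult.commute)
      finally show ?thesis .
    qed
    have "monomial_span (\<lambda>x. \<Sum>i\<in>UNIV. h (axis i 1) * (x $ i * f x))"
      using linear.prems by (intro monomial_span_sum monomial_span.scale monomial_span_coord) auto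
    moreover have "(\<Sum>i\<in>UNIV. h (axis i 1) * (x $ i * f x)) = h x * f x" for x
      unfolding h[of x] by (simp add: sum_distrib_right mult.assoc)
    ultimately show ?case by simp
  next
    case (const c)
    then show ?case by (rule monomial_span.scale)
  next
    case (add g h)
    then show ?case by (simp add: distrib_right monomial_span.add)
  next
    case (mult g h)
    then show ?case by (simp add: mult.assoc)
  qed
  from this[OF monomial_span.monomial[of "{#}"]] show ?thesis by simp
qed

section \<open>From moments to weak convergence\<close>

lemma integrable_on_simplex:
  fixes f :: "real ^ 'm::finite \<Rightarrow> real"
  assumes "prob_space \<nu>" "sets \<nu> = sets borel" "AE x in \<nu>. x \<in> prob_simplex"
    and "f \<in> borel_measurable borel" "\<And>x. x \<in> prob_simplex \<Longrightarrow> \<bar>f x\<bar> \<le> B"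
  shows "integrable \<nu> f"
proof -
  interpret prob_space \<nu> by fact
  show ?thesis
  proof (rule integrable_const_bound[of _ B])
    show "AE x in \<nu>. norm (f x) \<le> B" using assms(3) by eventually_elim (simp add: assms(5))
    show "f \<in> borel_measurable \<nu>" using assms(2,4) by (simp cong: measurable_cong_sets)
  qed
qed

text \<open>Stone--Weierstrass approximates a continuous function by polynomials uniformly on the
  simplex, which carries all the mass. The index 0 is exempt from the support condition because
  \<open>occupation X 0\<close> is the zero vector, which lies off the simplex.\<close>

lemma moments_imp_weak_convergence:
  fixes \<nu> :: "nat \<Rightarrow> (real ^ 'm::finite) measure"
  assumes prob: "\<And>n. prob_space (\<nu> n)" "prob_space \<mu>"
    and sets: "\<And>n. sets (\<nu> n) = sets borel" "sets \<mu> = sets borel"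
    and simplex: "\<And>n. n > 0 \<Longrightarrow> AE x in \<nu> n. x \<in> prob_simplex" "AE x in \<mu>. x \<in> prob_simplex"
    and mom: "\<And>A. (\<lambda>n. integral\<^sup>L (\<nu> n) (monomial A)) \<longlonglongrightarrow> integral\<^sup>L \<mu> (monomial A)"
  shows "weakly_converges \<nu> \<mu>"
  unfolding weakly_converges_def
proof (intro allI impI, elim conjE)
  fix f :: "real ^ 'm \<Rightarrow> real"
  assume cont: "continuous_on UNIV f" and bdd: "bounded (range f)"
  from bdd obtain B where B: "\<And>x. \<bar>f x\<bar> \<le> B" by (auto simp: bounded_iff)
  have f_meas: "f \<in> borel_measurable borel" using cont by (rule borel_measurable_continuous_onI)
  \<comment> \<open>Measurability and a bound on the simplex are carried along in the induction,
    since splitting the integral of a sum requires integrability of both parts.\<close>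
  have span: "g \<in> borel_measurable borel \<and> (\<exists>B. \<forall>x\<in>prob_simplex. \<bar>g x\<bar> \<le> B)
      \<and> (\<lambda>n. integral\<^sup>L (\<nu> n) g) \<longlonglongrightarrow> integral\<^sup>L \<mu> g"
    if "monomial_span g" for g
    using that
  proof induction
    case (monomial A)
    then show ?case using mom monomial_bounds[of _ A] by (auto intro!: exI[of _ 1])
  next
    case (scale g c)
    then obtain B where "\<forall>x\<in>prob_simplex. \<bar>g x\<bar> \<le> B" by auto
    then have "\<forall>x\<in>prob_simplex. \<bar>c * g x\<bar> \<le> \<bar>c\<bar> * B" by (auto simp: abs_mult mult_left_mono)
    then show ?case using scale by (auto intro!: tendsto_intros)
  next
    case (add g h)
    then obtain B B' where B: "\<forall>x\<in>prob_simplex. \<bar>g x\<bar> \<le> B" "\<forall>x\<in>prob_simplex. \<bar>h x\<bar> \<le> B'" by auto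
    then have B': "\<forall>x\<in>prob_simplex. \<bar>g x + h x\<bar> \<le> B + B'"
      by (auto intro!: order_trans[OF abs_triangle_ineq] add_mono)
    have int: "integrable \<rho> g" "integrable \<rho> h"
      if "prob_space \<rho>" "sets \<rho> = sets borel" "AE x in \<rho>. x \<in> prob_simplex" for \<rho>
      using add B that by (auto intro: integrable_on_simplex)
    have "(\<lambda>n. integral\<^sup>L (\<nu> n) g + integral\<^sup>L (\<nu> n) h) \<longlonglongrightarrow> integral\<^sup>L \<mu> g + integral\<^sup>L \<mu> h"
      using add by (intro tendsto_add) auto
    also have "integral\<^sup>L \<mu> g + integral\<^sup>L \<mu> h = integral\<^sup>L \<mu> (\<lambda>x. g x + h x)"
      using int[OF prob(2) sets(2) simplex(2)] by simp
    finally have "(\<lambda>n. integral\<^sup>L (\<nu> n) (\<lambda>x. g x + h x)) \<longlonglongrightarrow> integral\<^sup>L \<mu> (\<lambda>x. g x + h x)"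
    proof (rule Lim_transform_eventually)
      show "\<forall>\<^sub>F n in sequentially. integral\<^sup>L (\<nu> n) g + integral\<^sup>L (\<nu> n) h = integral\<^sup>L (\<nu> n) (\<lambda>x. g x + h x)"
        using eventually_gt_at_top[of 0]
        by eventually_elim (use int[OF prob(1) sets(1) simplex(1)] in simp)
    qed
    then show ?case using add B' by auto
  qed
  show "(\<lambda>n. integral\<^sup>L (\<nu> n) f) \<longlonglongrightarrow> integral\<^sup>L \<mu> f"
  proof (rule LIMSEQ_I)
    fix e :: real assume "e > 0"
    from Stone_Weierstrass_real_polynomial_function[OF compact_prob_simplex continuous_on_subset[OF cont], of "e / 3"]
      \<open>e > 0\<close> obtain g where g: "real_polynomial_function g"
        "\<And>x. x \<in> prob_simplex \<Longrightarrow> \<bar>f x - g x\<bar> < e / 3" by auto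
    from span[OF real_polynomial_function_monomial_span[OF g(1)]]
    obtain C where g_meas: "g \<in> borel_measurable borel"
      and C: "\<And>x. x \<in> prob_simplex \<Longrightarrow> \<bar>g x\<bar> \<le> C"
      and lim: "(\<lambda>n. integral\<^sup>L (\<nu> n) g) \<longlonglongrightarrow> integral\<^sup>L \<mu> g" by auto
    have close: "\<bar>integral\<^sup>L \<rho> f - integral\<^sup>L \<rho> g\<bar> \<le> e / 3"
      if \<rho>: "prob_space \<rho>" "sets \<rho> = sets borel" "AE x in \<rho>. x \<in> prob_simplex" for \<rho>
    proof -
      interpret prob_space \<rho> by fact
      have int: "integrable \<rho> f" "integrable \<rho> g"
        using \<rho> f_meas g_meas B C by (auto intro: integrable_on_simplex)
      have "\<bar>integral\<^sup>L \<rho> f - integral\<^sup>L \<rho> g\<bar> = \<bar>\<integral>x. f x - g x \<partial>\<rho>\<bar>"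
        using int by simp
      also have "\<dots> \<le> (\<integral>x. \<bar>f x - g x\<bar> \<partial>\<rho>)" by (rule integral_abs_bound)
      also have "\<dots> \<le> (\<integral>x. e / 3 \<partial>\<rho>)"
        using int \<rho>(3) by (intro integral_mono_AE) (auto elim!: eventually_mono dest!: g(2))
      finally show ?thesis by (simp add: prob_space)
    qed
    from LIMSEQ_D[OF lim, of "e / 3"] \<open>e > 0\<close> obtain N
      where N: "\<And>n. n \<ge> N \<Longrightarrow> \<bar>integral\<^sup>L (\<nu> n) g - integral\<^sup>L \<mu> g\<bar> < e / 3" by auto
    have "\<bar>integral\<^sup>L (\<nu> n) f - integral\<^sup>L \<mu> f\<bar> < e" if "n \<ge> max N 1" for n
    proof -
      have "\<bar>integral\<^sup>L (\<nu> n) f - integral\<^sup>L (\<nu> n) g\<bar> \<le> e / 3"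
        using that by (intro close prob sets simplex) simp
      moreover have "\<bar>integral\<^sup>L \<mu> f - integral\<^sup>L \<mu> g\<bar> \<le> e / 3"
        by (intro close prob sets simplex)
      moreover have "\<bar>integral\<^sup>L (\<nu> n) g - integral\<^sup>L \<mu> g\<bar> < e / 3"
        using that by (intro N) simp
      ultimately show ?thesis by linarith
    qed
    then show "\<exists>no. \<forall>n\<ge>no. norm (integral\<^sup>L (\<nu> n) f - integral\<^sup>L \<mu> f) < e"
      by (intro exI[of _ "max N 1"]) simp
  qed
qed

text \<open>Closed sets form an intersection-stable generator of the Borel sets, and their
  indicators are pointwise limits of bounded continuous functions.\<close>

lemma measure_eqI_bounded_continuous:
  fixes \<mu> \<nu> :: "('a::metric_space) measure"
  assumes "prob_space \<mu>" "prob_space \<nu>" and sets: "sets \<mu> = sets borel" "sets \<nu> = sets borel"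
    and eq: "\<And>f :: 'a \<Rightarrow> real. continuous_on UNIV f \<Longrightarrow> bounded (range f) \<Longrightarrow> integral\<^sup>L \<mu> f = integral\<^sup>L \<nu> f"
  shows "\<mu> = \<nu>"
proof -
  interpret \<mu>: prob_space \<mu> by fact
  interpret \<nu>: prob_space \<nu> by fact
  \<comment> \<open>Equal to 1 on \<open>C\<close> and to 0 beyond distance \<open>1 / k\<close>;
    for closed nonempty \<open>C\<close> it tends to the indicator of \<open>C\<close>.\<close>
  define f where "f C k x = max 0 (1 - real k * infdist x C)" for C :: "'a set" and k x
  have f_cont: "continuous_on UNIV (f C k)" for C k
    unfolding f_def by (intro continuous_intros)
  have f_le: "\<bar>f C k x\<bar> \<le> 1" for C k x
    by (simp add: f_def infdist_nonneg)
  have lim: "(\<lambda>k. integral\<^sup>L \<rho> (f C k)) \<longlonglongrightarrow> measure \<rho> C"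
    if \<rho>: "prob_space \<rho>" "sets \<rho> = sets borel" and C: "closed C" "C \<noteq> {}" for \<rho> C
  proof -
    interpret prob_space \<rho> by fact
    have "(\<lambda>k. integral\<^sup>L \<rho> (f C k)) \<longlonglongrightarrow> integral\<^sup>L \<rho> (indicator C)"
    proof (rule integral_dominated_convergence[where w = "\<lambda>_. 1"])
      show "indicator C \<in> borel_measurable \<rho>" using C \<rho>(2) by (intro borel_measurable_indicator) auto
      show "f C k \<in> borel_measurable \<rho>" for k
        using borel_measurable_continuous_onI[OF f_cont, of C k] \<rho>(2)
        by (simp cong: measurable_cong_sets)
      show "AE x in \<rho>. (\<lambda>k. f C k x) \<longlonglongrightarrow> indicator C x"
      proof (rule AE_I2)
        fix x
        show "(\<lambda>k. f C k x) \<longlonglongrightarrow> indicator C x"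
        proof (cases "x \<in> C")
          case True
          then show ?thesis by (simp add: f_def)
        next
          case False
          then have "infdist x C > 0"
            using C in_closed_iff_infdist_zero[of C x] infdist_nonneg[of x C] by fastforce
          then obtain N where N: "1 < real N * infdist x C"
            using ex_less_of_nat_mult by blast
          have "f C k x = 0" if "k \<ge> N" for k
          proof -
            have "real N * infdist x C \<le> real k * infdist x C"
              using that by (intro mult_right_mono infdist_nonneg) simp
            then show ?thesis using N by (simp add: f_def)
          qed
          then show ?thesis using False
            by (intro tendsto_eventually eventually_sequentiallyI[of N]) simp
        qed
      qed
    qed (use f_le in auto)
    then show ?thesis using C \<rho>(2) by (simp add: emeasure_eq_measure)
  qed
  show ?thesis
  proof (rule measure_eqI_generator_eq[where E = "Collect closed" and \<Omega> = UNIV and A = "\<lambda>_. UNIV"])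
    fix C :: "'a set" assume "C \<in> Collect closed"
    then have C: "closed C" by simp
    show "emeasure \<mu> C = emeasure \<nu> C"
    \<comment> \<open>The empty set is treated apart because \<open>infdist\<close> to it is 0 by
      convention, which would make \<open>f\<close> constantly 1.\<close>
    proof (cases "C = {}")
      case False
      have "integral\<^sup>L \<mu> (f C k) = integral\<^sup>L \<nu> (f C k)" for k
        using f_cont f_le by (intro eq) (auto simp: bounded_iff intro!: exI[of _ 1])
      then have "measure \<mu> C = measure \<nu> C"
        using lim[OF assms(1) sets(1) C False] lim[OF assms(2) sets(2) C False]
        by (simp add: LIMSEQ_unique)
      then show ?thesis by (simp add: \<mu>.emeasure_eq_measure \<nu>.emeasure_eq_measure)
    qed simp
  qed (auto simp: Int_stable_def sets borel_eq_closed)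
qed

subsection \<open>Markov chains and occupation vectors\<close>

text \<open>For every time and every state an independent successor is drawn from the corresponding
  row of \<open>P\<close>; the chain then follows the draws. Existence is what keeps the universal
  statement in \<open>occupation_limit\<close> from being vacuous.\<close>

lemma ex_markov_chain:
  fixes P :: "nat \<Rightarrow> real ^ 'm::finite ^ 'm"
  assumes nonneg: "\<And>n i j. P n $ i $ j \<ge> 0" and sum: "\<And>n i. (\<Sum>j\<in>UNIV. P n $ i $ j) = 1"
  shows "\<exists>(M :: (nat \<Rightarrow> 'm) measure) X. markov_chain M X (return_pmf s) P"
proof -
  define r where "r p = embed_pmf (\<lambda>j. P (fst p) $ snd p $ j)" for p :: "nat \<times> 'm"
  have r: "pmf (r p) j = P (fst p) $ snd p $ j" for p j
    unfolding r_def using nonneg sum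
    by (subst pmf_embed_pmf) (auto simp: nn_integral_count_space_finite)
  define Q where "Q = (\<Pi>\<^sub>M p\<in>UNIV. measure_pmf (r p))"
  interpret Q: prob_space Q
    unfolding Q_def by (intro prob_space_PiM measure_pmf.prob_space_axioms)
  have space_Q: "space Q = UNIV" by (simp add: Q_def space_PiM)
  define Y where "Y n \<omega> = rec_nat s (\<lambda>k y. \<omega> (Suc k, y)) n" for n and \<omega> :: "nat \<times> 'm \<Rightarrow> 'm"
  have Y_simps: "Y 0 \<omega> = s" "Y (Suc n) \<omega> = \<omega> (Suc n, Y n \<omega>)" for n \<omega>
    by (simp_all add: Y_def)
  have component: "(\<lambda>\<omega>. \<omega> p) \<in> Q \<rightarrow>\<^sub>M count_space UNIV" for p
  proof -
    have "(\<lambda>\<omega>. \<omega> p) \<in> Q \<rightarrow>\<^sub>M measure_pmf (r p)"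
      unfolding Q_def by (rule measurable_component_singleton) simp
    also have "Q \<rightarrow>\<^sub>M measure_pmf (r p) = Q \<rightarrow>\<^sub>M count_space UNIV"
      by (rule measurable_cong_sets) auto
    finally show ?thesis .
  qed
  have Y_meas [measurable]: "Y n \<in> Q \<rightarrow>\<^sub>M count_space UNIV" for n
  proof (induction n)
    case (Suc n)
    have "(\<lambda>\<omega>. \<omega> (Suc n, Y n \<omega>)) \<in> Q \<rightarrow>\<^sub>M count_space UNIV"
      by (rule measurable_compose_countable'[where I = UNIV and f = "\<lambda>i \<omega>. \<omega> (Suc n, i)"])
         (use component Suc in auto)
    then show ?case by (simp add: Y_simps[abs_def])
  qed (simp add: Y_simps[abs_def])
  \<comment> \<open>Following a prescribed path reads only the draws at \<open>(Suc k, x k)\<close>,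
    so the event is a cylinder with deterministic indices.\<close>
  have path_iff: "(\<forall>k\<le>n. Y k \<omega> = x k) \<longleftrightarrow> x 0 = s \<and> (\<forall>k<n. \<omega> (Suc k, x k) = x (Suc k))" for n \<omega> x
  proof (induction n)
    case (Suc n)
    have "(\<forall>k\<le>Suc n. Y k \<omega> = x k) \<longleftrightarrow> (\<forall>k\<le>n. Y k \<omega> = x k) \<and> Y (Suc n) \<omega> = x (Suc n)"
      by (auto simp: le_Suc_eq)
    also have "\<dots> \<longleftrightarrow> (\<forall>k\<le>n. Y k \<omega> = x k) \<and> \<omega> (Suc n, x n) = x (Suc n)"
      by (auto simp: Y_simps)
    finally show ?case unfolding Suc by (auto simp: less_Suc_eq)
  qed (auto simp: Y_simps)
  have path_prob: "measure Q {\<omega>. \<forall>k\<le>n. Y k \<omega> = x k}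
      = (if x 0 = s then \<Prod>k<n. P (Suc k) $ x k $ x (Suc k) else 0)" for n x
  proof (cases "x 0 = s")
    case True
    define J where "J = (\<lambda>k. (Suc k, x k)) ` {..<n}"
    have "{\<omega>. \<forall>k\<le>n. Y k \<omega> = x k}
      = prod_emb UNIV (\<lambda>p. measure_pmf (r p)) J (Pi\<^sub>E J (\<lambda>p. {x (fst p)}))"
      unfolding path_iff by (auto simp: True J_def prod_emb_def PiE_iff)
    moreover have "emeasure Q (prod_emb UNIV (\<lambda>p. measure_pmf (r p)) J (Pi\<^sub>E J (\<lambda>p. {x (fst p)})))
      = (\<Prod>p\<in>J. emeasure (measure_pmf (r p)) {x (fst p)})"
      unfolding Q_def by (rule emeasure_PiM_emb) (auto simp: J_def measure_pmf.prob_space_axioms)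
    \<comment> \<open>The indices in \<open>J\<close> carry different times, hence are distinct, and
      the product over \<open>J\<close> is a product over the steps.\<close>
    moreover have "\<dots> = ennreal (\<Prod>k<n. P (Suc k) $ x k $ x (Suc k))"
      unfolding J_def by (subst prod.reindex)
        (auto simp: inj_on_def emeasure_pmf_single r prod_ennreal nonneg)
    ultimately show ?thesis using True
      by (simp add: measure_def prod_nonneg nonneg)
  next
    case False
    then have "{\<omega>. \<forall>k\<le>n. Y k \<omega> = x k} = {}" unfolding path_iff by auto
    then show ?thesis using False by (simp only: measure_empty if_False)
  qed
  \<comment> \<open>The law of \<open>Y\<close> is carried over to the path type demanded by the
    statement, with the coordinates as the chain.\<close>
  define M where "M = distr Q (\<Pi>\<^sub>M n\<in>UNIV. count_space UNIV) (\<lambda>\<omega> n. Y n \<omega>)"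
  have Y_meas' [measurable]: "(\<lambda>\<omega> n. Y n \<omega>) \<in> Q \<rightarrow>\<^sub>M (\<Pi>\<^sub>M n\<in>UNIV. count_space UNIV)"
    by (rule measurable_PiM_single') (auto simp: space_PiM)
  have space_M: "space M = UNIV" by (simp add: M_def space_PiM)
  have prob_M: "measure M {x. \<forall>k\<le>n. x k = y k} = measure Q {\<omega>. \<forall>k\<le>n. Y k \<omega> = y k}" for n y
  proof -
    have "Measurable.pred (\<Pi>\<^sub>M n\<in>UNIV. count_space UNIV) (\<lambda>x. \<forall>k\<le>n. x k = y k)"
      by measurable
    then have "{x. \<forall>k\<le>n. x k = y k} \<in> sets (\<Pi>\<^sub>M n\<in>UNIV. count_space UNIV)"
      by (simp add: pred_def space_PiM)
    then show ?thesis unfolding M_def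
      by (subst measure_distr[OF Y_meas']) (auto simp: space_Q vimage_def)
  qed
  have "markov_chain M (\<lambda>n x. x n) (return_pmf s) P"
    unfolding markov_chain_def space_M
  proof (intro conjI allI impI)
    show "prob_space M" unfolding M_def by (rule Q.prob_space_distr) measurable
    show "(\<lambda>x. x n) \<in> M \<rightarrow>\<^sub>M count_space UNIV" for n
      unfolding M_def by measurable
    show "measure M {\<omega> \<in> UNIV. \<omega> 0 = i} = pmf (return_pmf s) i" for i
      using prob_M[of 0 "\<lambda>_. i"] path_prob[of 0 "\<lambda>_. i"] by (auto simp: indicator_def)
    fix n and x :: "nat \<Rightarrow> 'm" and j
    assume ne: "measure M {\<omega> \<in> UNIV. \<forall>k\<le>n. \<omega> k = x k} \<noteq> 0"
    define y where "y = x(Suc n := j)"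
    have "{\<omega>. \<omega> (Suc n) = j \<and> (\<forall>k\<le>n. \<omega> k = x k)} = {\<omega>. \<forall>k\<le>Suc n. \<omega> k = y k}"
      by (auto simp: y_def le_Suc_eq)
    moreover have "(\<Prod>k<n. P (Suc k) $ y k $ y (Suc k)) = (\<Prod>k<n. P (Suc k) $ x k $ x (Suc k))"
      by (intro prod.cong) (auto simp: y_def)
    ultimately have "measure M {\<omega>. \<omega> (Suc n) = j \<and> (\<forall>k\<le>n. \<omega> k = x k)}
        = P (Suc n) $ x n $ j * measure M {\<omega>. \<forall>k\<le>n. \<omega> k = x k}"
      by (simp add: prob_M path_prob) (simp add: y_def)
    then show "\<P>(\<omega> in M. \<omega> (Suc n) = j \<bar> \<forall>k\<le>n. \<omega> k = x k) = P (Suc n) $ x n $ j"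
      using ne by (simp add: cond_prob_def space_M)
  qed
  then show ?thesis by blast
qed

lemma trans_mat_stochastic:
  fixes G :: "real ^ 'm::finite ^ 'm"
  assumes "G \<in> generators"
  shows "trans_mat G n $ i $ j \<ge> 0" "(\<Sum>j\<in>UNIV. trans_mat G n $ i $ j) = 1"
proof -
  have off: "G $ i $ j > 0" if "i \<noteq> j" for i j using assms that by (auto simp: generators_def)
  have "G $ i $ i = - (\<Sum>j\<in>UNIV - {i}. G $ i $ j)" using assms by (auto simp: generators_def)
  then have row: "(\<Sum>j\<in>UNIV. G $ i $ j) = 0"
    by (subst sum.remove[of _ i]) auto
  have one: "(\<Sum>j\<in>UNIV. (mat 1 :: real ^ 'm ^ 'm) $ i $ j) = 1"
    by (simp add: mat_def)
  show "(\<Sum>j\<in>UNIV. trans_mat G n $ i $ j) = 1"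
    using one row by (simp add: trans_mat_def sum.distrib sum_divide_distrib[symmetric])
  show "trans_mat G n $ i $ j \<ge> 0"
  proof (cases "n \<le> start_index G")
    case True
    then show ?thesis by (simp add: trans_mat_def mat_def)
  next
    case False
    have "\<bar>G $ i $ i\<bar> \<le> Max (range (\<lambda>i. \<bar>G $ i $ i\<bar>))" by (intro Max_ge) auto
    also have "\<dots> \<le> real (start_index G)" unfolding start_index_def by (rule real_nat_ceiling_ge)
    also have "\<dots> < real n" using False by simp
    finally have "\<bar>G $ i $ i\<bar> < real n" .
    then have "0 \<le> 1 + G $ i $ i / real n" by (auto simp: field_simps abs_less_iff)
    then show ?thesis using False off[of i j]
      by (cases "i = j") (auto simp: trans_mat_def mat_def)
  qed
qed

text \<open>The conditional probability multiplied out. On histories of probability 0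
  \<open>markov_chain\<close> says nothing, but there both sides vanish by monotonicity.\<close>

lemma markov_chain_path_step:
  fixes X :: "nat \<Rightarrow> 'a \<Rightarrow> 'm::finite"
  assumes mc: "markov_chain M X \<pi> P"
  shows "measure M {\<omega>\<in>space M. X (Suc n) \<omega> = j \<and> (\<forall>k\<le>n. X k \<omega> = x k)}
    = P (Suc n) $ x n $ j * measure M {\<omega>\<in>space M. \<forall>k\<le>n. X k \<omega> = x k}"
proof (cases "measure M {\<omega>\<in>space M. \<forall>k\<le>n. X k \<omega> = x k} = 0")
  case False
  then have "\<P>(\<omega> in M. X (Suc n) \<omega> = j \<bar> \<forall>k\<le>n. X k \<omega> = x k) = P (Suc n) $ x n $ j"
    using mc by (auto simp: markov_chain_def)
  then show ?thesis using False by (simp add: cond_prob_def field_simps)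
next
  case True
  interpret prob_space M using mc by (simp add: markov_chain_def)
  have X [measurable]: "X k \<in> M \<rightarrow>\<^sub>M count_space UNIV" for k
    using mc by (simp add: markov_chain_def)
  have "measure M {\<omega>\<in>space M. X (Suc n) \<omega> = j \<and> (\<forall>k\<le>n. X k \<omega> = x k)}
      \<le> measure M {\<omega>\<in>space M. \<forall>k\<le>n. X k \<omega> = x k}"
    by (intro finite_measure_mono) auto
  then show ?thesis using True by (simp add: measure_le_0_iff)
qed

text \<open>A function of finitely many steps takes finitely many values, so its integral is a
  finite sum over path segments. The event \<open>E\<close> may look beyond time
  \<open>n\<close>.\<close>

lemma integral_path_function:
  fixes X :: "nat \<Rightarrow> 'a \<Rightarrow> 'm::finite" and F :: "(nat \<Rightarrow> 'm) \<Rightarrow> real"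
  assumes "prob_space M" and X: "\<And>k. X k \<in> M \<rightarrow>\<^sub>M count_space UNIV"
    and F: "\<And>x y. (\<And>k. k \<le> n \<Longrightarrow> x k = y k) \<Longrightarrow> F x = F y"
    and E: "{\<omega>\<in>space M. E \<omega>} \<in> sets M"
  shows "(\<integral>\<omega>. F (\<lambda>k. X k \<omega>) * of_bool (E \<omega>) \<partial>M) =
    (\<Sum>x\<in>({..n} \<rightarrow>\<^sub>E UNIV). F x * measure M {\<omega>\<in>space M. E \<omega> \<and> (\<forall>k\<le>n. X k \<omega> = x k)})"
proof -
  interpret prob_space M by fact
  note X [measurable] E [measurable]
  let ?S = "{..n} \<rightarrow>\<^sub>E (UNIV :: 'm set)"
  let ?A = "\<lambda>x. {\<omega>\<in>space M. E \<omega> \<and> (\<forall>k\<le>n. X k \<omega> = x k)}"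
  have fin: "finite ?S" by (intro finite_PiE) auto
  have A: "?A x \<in> sets M" for x by measurable
  have "(\<integral>\<omega>. F (\<lambda>k. X k \<omega>) * of_bool (E \<omega>) \<partial>M) = (\<integral>\<omega>. (\<Sum>x\<in>?S. F x * indicator (?A x) \<omega>) \<partial>M)"
  proof (rule Bochner_Integration.integral_cong[OF refl])
    fix \<omega> assume \<omega>: "\<omega> \<in> space M"
    \<comment> \<open>The restriction to \<open>{..n}\<close> is the only extensional path segment
      whose event can contain \<omega>, so the sum collapses to one term.\<close>
    define p where "p = restrict (\<lambda>k. X k \<omega>) {..n}"
    have p: "p \<in> ?S" by (simp add: p_def)
    have eq: "(\<forall>k\<le>n. X k \<omega> = x k) \<longleftrightarrow> x = p" if "x \<in> ?S" for x
    proof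
      assume "\<forall>k\<le>n. X k \<omega> = x k"
      then show "x = p" using that p by (intro PiE_ext[of x "{..n}" "\<lambda>_. UNIV"]) (auto simp: p_def)
    qed (simp add: p_def)
    have "(\<Sum>x\<in>?S. F x * indicator (?A x) \<omega>) = (\<Sum>x\<in>?S. if x = p then F p * of_bool (E \<omega>) else 0)"
      using \<omega> eq by (intro sum.cong) (auto simp: indicator_def)
    also have "\<dots> = F p * of_bool (E \<omega>)" using p fin by simp
    also have "F p = F (\<lambda>k. X k \<omega>)" by (rule F) (simp add: p_def)
    finally show "F (\<lambda>k. X k \<omega>) * of_bool (E \<omega>) = (\<Sum>x\<in>?S. F x * indicator (?A x) \<omega>)" by simp
  qed
  also have "\<dots> = (\<Sum>x\<in>?S. F x * measure M (?A x))"
    using A by (subst Bochner_Integration.integral_sum)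
      (auto intro!: integrable_mult_right integrable_real_indicator simp: emeasure_eq_measure)
  finally show ?thesis .
qed

text \<open>The Markov property in integrated form: after a factor depending on the past, the
  indicator of the next state may be replaced by its transition probability. Both sides are expanded
  over path segments, which avoids conditional expectations.\<close>

lemma markov_chain_integral_step:
  fixes X :: "nat \<Rightarrow> 'a \<Rightarrow> 'm::finite" and F :: "(nat \<Rightarrow> 'm) \<Rightarrow> real"
  assumes mc: "markov_chain M X \<pi> P"
    and F: "\<And>x y. (\<And>k. k \<le> n \<Longrightarrow> x k = y k) \<Longrightarrow> F x = F y"
  shows "(\<integral>\<omega>. F (\<lambda>k. X k \<omega>) * of_bool (X (Suc n) \<omega> = j) \<partial>M)
    = (\<integral>\<omega>. F (\<lambda>k. X k \<omega>) * P (Suc n) $ X n \<omega> $ j \<partial>M)"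
proof -
  have M: "prob_space M" and X [measurable]: "\<And>k. X k \<in> M \<rightarrow>\<^sub>M count_space UNIV"
    using mc by (auto simp: markov_chain_def)
  let ?S = "{..n} \<rightarrow>\<^sub>E (UNIV :: 'm set)"
  have "(\<integral>\<omega>. F (\<lambda>k. X k \<omega>) * of_bool (X (Suc n) \<omega> = j) \<partial>M) =
      (\<Sum>x\<in>?S. F x * (P (Suc n) $ x n $ j * measure M {\<omega>\<in>space M. \<forall>k\<le>n. X k \<omega> = x k}))"
    unfolding markov_chain_path_step[OF mc, symmetric]
    by (rule integral_path_function[OF M X F]) measurable
  also have "\<dots> = (\<Sum>x\<in>?S. (F x * P (Suc n) $ x n $ j) *
      measure M {\<omega>\<in>space M. True \<and> (\<forall>k\<le>n. X k \<omega> = x k)})"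
    by (simp add: mult.assoc)
  also have "\<dots> = (\<integral>\<omega>. (F (\<lambda>k. X k \<omega>) * P (Suc n) $ X n \<omega> $ j) * of_bool True \<partial>M)"
    by (rule integral_path_function[OF M X, of n "\<lambda>x. F x * P (Suc n) $ x n $ j" "\<lambda>_. True", symmetric])
       (auto intro!: arg_cong2[where f = "(*)"] F)
  finally show ?thesis by simp
qed

section \<open>Occupation vectors\<close>

lemma occupation_eq_sum:
  fixes X :: "nat \<Rightarrow> 'a \<Rightarrow> 'm::finite"
  shows "occupation X n \<omega> = (1 / real n) *\<^sub>R (\<Sum>k=1..n. axis (X k \<omega>) 1)"
proof -
  have "axis (X k \<omega>) (1::real) $ i = indicator {i} (X k \<omega>)" for k i
    by (simp add: axis_def indicator_def)
  then show ?thesis by (simp add: vec_eq_iff occupation_def)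
qed

lemma occupation_measurable:
  fixes X :: "nat \<Rightarrow> 'a \<Rightarrow> 'm::finite"
  assumes [measurable]: "\<And>k. X k \<in> M \<rightarrow>\<^sub>M count_space UNIV"
  shows "occupation X n \<in> borel_measurable M"
  unfolding occupation_eq_sum[abs_def] by measurable

lemma occupation_in_simplex:
  fixes X :: "nat \<Rightarrow> 'a \<Rightarrow> 'm::finite"
  assumes "n > 0"
  shows "occupation X n \<omega> \<in> prob_simplex"
proof -
  have "(\<Sum>k=1..n. indicator {i} (X k \<omega>)) \<le> (\<Sum>k=1..n. (1::real))" for i
    by (intro sum_mono) (simp add: indicator_def)
  then have "(\<Sum>k=1..n. indicator {i} (X k \<omega>)) \<le> real n" for i by simp
  moreover have "(\<Sum>i\<in>UNIV. (\<Sum>k=1..n. indicator {i} (X k \<omega>)) / real n) = 1"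
    unfolding sum_divide_distrib[symmetric] using assms
    by (subst sum.swap) (simp add: indicator_def)
  ultimately show ?thesis using assms
    by (auto simp: prob_simplex_def occupation_def sum_nonneg)
qed

lemma occupation_Suc:
  fixes X :: "nat \<Rightarrow> 'a \<Rightarrow> 'm::finite"
  shows "occupation X (Suc n) \<omega> = occupation X n \<omega> +
    (1 / (real n + 1)) *\<^sub>R (axis (X (Suc n) \<omega>) 1 - occupation X n \<omega>)"
proof (cases "n = 0")
  \<comment> \<open>\<open>occupation X 0\<close> is the zero vector, and the step of length 1 ends
    at the vertex belonging to \<open>X 1 \<omega>\<close>.\<close>
  case True
  then show ?thesis by (simp add: occupation_eq_sum)
next
  case False
  define S where "S = (\<Sum>k=1..n. axis (X k \<omega>) (1::real))"
  have "(\<Sum>k=1..Suc n. axis (X k \<omega>) (1::real)) = S + axis (X (Suc n) \<omega>) 1"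
    by (simp add: S_def)
  moreover have "(x + y) / (real n + 1) = x / real n + (y - x / real n) / (real n + 1)" for x y :: real
    using False by (simp add: divide_simps) (simp add: algebra_simps)
  ultimately show ?thesis
    by (simp add: occupation_eq_sum S_def[symmetric] vec_eq_iff add.commute[of 1])
qed

lemma occupation_cong:
  assumes "\<And>k. k \<le> n \<Longrightarrow> x k = y k"
  shows "occupation (\<lambda>k z. z k) n x = occupation (\<lambda>k z. z k) n y"
  using assms by (simp add: occupation_def)

text \<open>Writes the occupation vector as a function of the path, the form to which
  \<open>markov_chain_integral_step\<close> applies.\<close>

lemma occupation_path: "occupation X n \<omega> = occupation (\<lambda>k z. z k) n (\<lambda>k. X k \<omega>)"
  by (simp add: occupation_def)

text \<open>All rows of \<open>Theta \<theta>\<close> equal \<theta> up to a multiple of the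
  identity. The part of the transition that changes the state therefore forgets the current state,
  and the moment recursion closes in the moments at \<open>j\<close> and the total moment.\<close>

lemma trans_mat_Theta:
  assumes "n \<ge> start_index (Theta \<theta>)"
  shows "trans_mat (Theta \<theta>) (Suc n) $ i $ j =
    of_bool (i = j) * (1 - (\<Sum>l\<in>UNIV. \<theta> $ l) / (real n + 1)) + \<theta> $ j / (real n + 1)"
  using assms by (auto simp: trans_mat_def mat_def Theta_def diff_divide_distrib add.commute)

lemma occupation_moment_recursion:
  fixes X :: "nat \<Rightarrow> 'a \<Rightarrow> 'm::finite"
  assumes mc: "markov_chain M X \<pi> (trans_mat (Theta \<theta>))" and \<theta>: "\<And>i. \<theta> $ i > 0"
  defines "m \<equiv> \<lambda>A j n. \<integral>\<omega>. monomial A (occupation X n \<omega>) * of_bool (X n \<omega> = j) \<partial>M"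
    and "s \<equiv> \<Sum>l\<in>UNIV. \<theta> $ l"
  shows "(\<lambda>n. (real n + 1) * (m A j (Suc n) - m A j n) + (real (size A) + s) * m A j n
    - (real (count A j) * m (A - {#j#}) j n + \<theta> $ j * (\<integral>\<omega>. monomial A (occupation X n \<omega>) \<partial>M)))
    \<longlonglongrightarrow> 0"
proof -
  interpret prob_space M using mc by (simp add: markov_chain_def)
  have X [measurable]: "X k \<in> M \<rightarrow>\<^sub>M count_space UNIV" for k
    using mc by (simp add: markov_chain_def)
  have [measurable]: "occupation X n \<in> borel_measurable M" for n
    by (rule occupation_measurable) measurable
  obtain C where C: "C \<ge> 0" "\<And>z j t. z \<in> prob_simplex \<Longrightarrow> 0 \<le> t \<Longrightarrow> t \<le> 1 \<Longrightarrow>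
     \<bar>monomial A (z + t *\<^sub>R (axis j 1 - z)) - monomial A z - t * monomial_drift A j z\<bar> \<le> C * t\<^sup>2"
    using monomial_segment_expansion[of A] by blast
  have s: "s \<ge> 0" unfolding s_def using \<theta> by (intro sum_nonneg) (simp add: less_imp_le)
  \<comment> \<open>The first summand bounds the Taylor remainder times the transition probability,
    the second the product of the drift with the first-order part of that probability.\<close>
  define K where "K = C * (1 + s + \<theta> $ j) + real (size A) * (\<theta> $ j + s)"
  define e where "e n = (real n + 1) * (m A j (Suc n) - m A j n) + (real (size A) + s) * m A j n
    - (real (count A j) * m (A - {#j#}) j n + \<theta> $ j * (\<integral>\<omega>. monomial A (occupation X n \<omega>) \<partial>M))" for n
  have bound: "\<bar>e n\<bar> \<le> K * (1 / (real n + 1))"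
    if n: "n \<ge> start_index (Theta \<theta>)" "n > 0" for n
  proof -
    define t where "t = 1 / (real n + 1)"
    have t: "0 < t" "t \<le> 1" "(real n + 1) * t = 1" by (auto simp: t_def)
    define Z where "Z \<omega> = occupation X n \<omega>" for \<omega>
    define \<delta> where "\<delta> \<omega> = (of_bool (X n \<omega> = j) :: real)" for \<omega>
    have [measurable]: "Z \<in> borel_measurable M" unfolding Z_def by measurable
    have [measurable]: "\<delta> \<in> borel_measurable M" unfolding \<delta>_def by measurable
    have Z: "Z \<omega> \<in> prob_simplex" for \<omega> unfolding Z_def using n(2) by (rule occupation_in_simplex)
    have \<delta>: "0 \<le> \<delta> \<omega>" "\<delta> \<omega> \<le> 1" for \<omega> by (auto simp: \<delta>_def)
    have mono_int [simp]: "integrable M (\<lambda>\<omega>. monomial B (Z \<omega>))" for B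
      using monomial_bounds[OF Z] by (intro integrable_const_bound[of _ 1]) auto
    have mono_int' [simp]: "integrable M (\<lambda>\<omega>. monomial B (Z \<omega>) * \<delta> \<omega>)" for B
      using monomial_bounds[OF Z] \<delta> by (intro integrable_const_bound[of _ 1]) (auto intro!: mult_le_one simp: abs_mult)
    \<comment> \<open>If the next state is \<open>j\<close>, this is the monomial at the next
      occupation vector; it depends only on the history up to time \<open>n\<close>.\<close>
    define W where "W \<omega> = monomial A (Z \<omega> + t *\<^sub>R (axis j 1 - Z \<omega>))" for \<omega>
    have [measurable]: "W \<in> borel_measurable M" unfolding W_def by measurable
    have W: "0 \<le> W \<omega> \<and> W \<omega> \<le> 1" for \<omega>
      unfolding W_def using t by (intro monomial_bounds simplex_segment Z) auto
    \<comment> \<open>The transition probability from \<open>X n \<omega>\<close> to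
      \<open>j\<close>, with \<delta> indicating that the chain is at \<open>j\<close>
      already.\<close>
    define p where "p \<omega> = \<delta> \<omega> * (1 - s * t) + \<theta> $ j * t" for \<omega>
    have [measurable]: "p \<in> borel_measurable M" unfolding p_def by measurable
    have p: "\<bar>p \<omega>\<bar> \<le> 1 + s + \<theta> $ j" for \<omega>
    proof -
      have "\<bar>1 - s * t\<bar> \<le> 1 + s" using s t mult_left_le[of t s] mult_nonneg_nonneg[of s t] by linarith
      then have "\<delta> \<omega> * \<bar>1 - s * t\<bar> \<le> 1 * (1 + s)" using \<delta>[of \<omega>] by (intro mult_mono) auto
      moreover have "\<theta> $ j * t \<le> \<theta> $ j * 1" "0 \<le> \<theta> $ j * t"
        using \<theta>[of j] t by (auto intro!: mult_left_mono)
      moreover have "\<bar>p \<omega>\<bar> \<le> \<bar>\<delta> \<omega> * (1 - s * t)\<bar> + \<bar>\<theta> $ j * t\<bar>"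
        unfolding p_def by (rule abs_triangle_ineq)
      ultimately show ?thesis using \<delta>(1)[of \<omega>] by (simp add: abs_mult)
    qed
    have p_int: "integrable M (\<lambda>\<omega>. W \<omega> * p \<omega>)"
    proof (rule integrable_const_bound[of _ "1 + s + \<theta> $ j"])
      have "\<bar>W \<omega>\<bar> * \<bar>p \<omega>\<bar> \<le> 1 * (1 + s + \<theta> $ j)" for \<omega>
        using W[of \<omega>] p[of \<omega>] by (intro mult_mono) auto
      then show "AE \<omega> in M. norm (W \<omega> * p \<omega>) \<le> 1 + s + \<theta> $ j" by (simp add: abs_mult)
    qed measurable
    have "m A j (Suc n) = (\<integral>\<omega>. W \<omega> * of_bool (X (Suc n) \<omega> = j) \<partial>M)"
      unfolding m_def W_def Z_def occupation_Suc t_def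
      by (intro Bochner_Integration.integral_cong) auto
    also have "\<dots> = (\<integral>\<omega>. W \<omega> * trans_mat (Theta \<theta>) (Suc n) $ X n \<omega> $ j \<partial>M)"
      unfolding W_def Z_def occupation_path[of X]
      by (rule markov_chain_integral_step[OF mc, of n "\<lambda>x. monomial A (occupation (\<lambda>k z. z k) n x +
          t *\<^sub>R (axis j 1 - occupation (\<lambda>k z. z k) n x))"]) (simp cong: occupation_cong)
    also have "\<dots> = (\<integral>\<omega>. W \<omega> * p \<omega> \<partial>M)"
      unfolding trans_mat_Theta[OF n(1)] p_def \<delta>_def s_def t_def by simp
    finally have m_Suc: "m A j (Suc n) = (\<integral>\<omega>. W \<omega> * p \<omega> \<partial>M)" .
    \<comment> \<open>\<open>W * p\<close> expanded to first order in \<open>t\<close>, with the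
      Taylor remainder dropped and the drift written out so that its integral is a combination of
      moments at time \<open>n\<close>.\<close>
    define V where "V \<omega> = monomial A (Z \<omega>) * \<delta> \<omega> + t * (real (count A j) * (monomial (A - {#j#}) (Z \<omega>) * \<delta> \<omega>)
      - real (size A) * (monomial A (Z \<omega>) * \<delta> \<omega>) - s * (monomial A (Z \<omega>) * \<delta> \<omega>)
      + \<theta> $ j * monomial A (Z \<omega>))" for \<omega>
    have V_int: "integrable M V" unfolding V_def by simp
    have V: "integral\<^sup>L M V = m A j n + t * (real (count A j) * m (A - {#j#}) j n
      - real (size A) * m A j n - s * m A j n + \<theta> $ j * (\<integral>\<omega>. monomial A (Z \<omega>) \<partial>M))"
      unfolding V_def m_def by (simp add: Z_def[symmetric] \<delta>_def[symmetric])
    have WV: "\<bar>W \<omega> * p \<omega> - V \<omega>\<bar> \<le> K * t\<^sup>2" for \<omega>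
    proof -
      define D where "D = monomial_drift A j (Z \<omega>)"
      define R where "R = W \<omega> - monomial A (Z \<omega>) - t * D"
      have R: "\<bar>R\<bar> \<le> C * t\<^sup>2" unfolding R_def W_def D_def using C(2) Z t by simp
      have D: "\<bar>D\<bar> \<le> real (size A)" unfolding D_def by (rule monomial_drift_bound[OF Z])
      have V_eq: "V \<omega> = monomial A (Z \<omega>) * \<delta> \<omega> + t * (D * \<delta> \<omega> - s * (monomial A (Z \<omega>) * \<delta> \<omega>)
          + \<theta> $ j * monomial A (Z \<omega>))"
        unfolding V_def D_def monomial_drift_def by (simp add: algebra_simps)
      have W_eq: "W \<omega> = monomial A (Z \<omega>) + t * D + R" by (simp add: R_def)
      \<comment> \<open>Here \<open>p\<close> is \<delta> plus \<open>t\<close> times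
        \<open>\<theta> $ j - s * \<delta> \<omega>\<close>; what survives is the Taylor remainder
        and the product of the two first-order terms.\<close>
      have "W \<omega> * p \<omega> - V \<omega> = R * p \<omega> + D * (t\<^sup>2 * (\<theta> $ j - s * \<delta> \<omega>))"
        unfolding V_eq W_eq by (simp add: p_def algebra_simps power2_eq_square)
      also have "\<bar>\<dots>\<bar> \<le> \<bar>R\<bar> * \<bar>p \<omega>\<bar> + \<bar>D\<bar> * (t\<^sup>2 * \<bar>\<theta> $ j - s * \<delta> \<omega>\<bar>)"
        by (rule order_trans[OF abs_triangle_ineq]) (simp add: abs_mult)
      also have "\<dots> \<le> (C * t\<^sup>2) * (1 + s + \<theta> $ j) + real (size A) * (t\<^sup>2 * (\<theta> $ j + s))"
      proof -
        have "0 \<le> s * \<delta> \<omega>" "s * \<delta> \<omega> \<le> s" using s \<delta>[of \<omega>] by (auto intro: mult_left_le)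
        then have "\<bar>\<theta> $ j - s * \<delta> \<omega>\<bar> \<le> \<theta> $ j + s" using \<theta>[of j] by linarith
        then show ?thesis using R p[of \<omega>] D C(1) by (intro add_mono mult_mono) auto
      qed
      also have "\<dots> = K * t\<^sup>2" by (simp add: K_def algebra_simps)
      finally show ?thesis .
    qed
    have "\<bar>m A j (Suc n) - integral\<^sup>L M V\<bar> = \<bar>\<integral>\<omega>. W \<omega> * p \<omega> - V \<omega> \<partial>M\<bar>"
      unfolding m_Suc using p_int V_int by simp
    also have "\<dots> \<le> (\<integral>\<omega>. \<bar>W \<omega> * p \<omega> - V \<omega>\<bar> \<partial>M)" by (rule integral_abs_bound)
    also have "\<dots> \<le> (\<integral>\<omega>. K * t\<^sup>2 \<partial>M)"
      using p_int V_int WV by (intro integral_mono) auto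
    finally have "\<bar>m A j (Suc n) - integral\<^sup>L M V\<bar> \<le> K * t\<^sup>2" by (simp add: prob_space)
    then have "(real n + 1) * \<bar>m A j (Suc n) - integral\<^sup>L M V\<bar> \<le> (real n + 1) * (K * t\<^sup>2)"
      by (intro mult_left_mono) auto
    also have "(real n + 1) * (K * t\<^sup>2) = ((real n + 1) * t) * (K * t)"
      by (simp add: power2_eq_square)
    also have "\<dots> = K * t" unfolding t(3) by simp
    \<comment> \<open>Since \<open>(n + 1) * t = 1\<close>, the defect \<open>e n\<close> is exactly
      \<open>n + 1\<close> times the error of the expansion, which leaves order
      \<open>t\<close>.\<close>
    also have "(real n + 1) * \<bar>m A j (Suc n) - integral\<^sup>L M V\<bar> = \<bar>e n\<bar>"
    proof -
      define Q where "Q = real (count A j) * m (A - {#j#}) j n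
        - real (size A) * m A j n - s * m A j n + \<theta> $ j * (\<integral>\<omega>. monomial A (Z \<omega>) \<partial>M)"
      have "(real n + 1) * (m A j (Suc n) - integral\<^sup>L M V)
          = (real n + 1) * (m A j (Suc n) - m A j n) - ((real n + 1) * t) * Q"
        unfolding V Q_def[symmetric] by (simp only: diff_add_eq_diff_diff_swap right_diff_distrib distrib_left mult.assoc)
      also have "\<dots> = e n" unfolding t(3) e_def Q_def Z_def by (simp add: distrib_right)
      finally show ?thesis by (metis abs_mult abs_of_nonneg add_nonneg_nonneg of_nat_0_le_iff zero_le_one)
    qed
    finally show ?thesis by (simp add: t_def)
  qed
  have "e \<longlonglongrightarrow> 0"
  proof (rule Lim_null_comparison)
    show "\<forall>\<^sub>F n in sequentially. norm (e n) \<le> K * (1 / (real n + 1))"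
      using eventually_ge_at_top[of "start_index (Theta \<theta>)"] eventually_gt_at_top[of 0]
      by eventually_elim (simp only: real_norm_def bound)
    show "(\<lambda>n. K * (1 / (real n + 1))) \<longlonglongrightarrow> 0" by real_asymp
  qed
  then show ?thesis by (simp only: e_def[abs_def])
qed

subsection \<open>The limit law\<close>

text \<open>Both limits are proved together: the total moment of \<open>A\<close> draws on the joint
  moments of lower degree, and the joint moments of \<open>A\<close> draw on its total
  moment.\<close>

lemma occupation_moment_limit:
  fixes X :: "nat \<Rightarrow> 'a \<Rightarrow> 'm::{finite,linorder}"
  assumes mc: "markov_chain M X \<pi> (trans_mat (Theta \<theta>))" and \<theta>: "\<And>i. \<theta> $ i > 0"
  shows "(\<lambda>n. \<integral>\<omega>. monomial A (occupation X n \<omega>) \<partial>M) \<longlonglongrightarrow> integral\<^sup>L (dirichlet \<theta>) (monomial A)"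
proof -
  interpret prob_space M using mc by (simp add: markov_chain_def)
  interpret D: prob_space "dirichlet \<theta>" by (rule prob_space_dirichlet[OF \<theta>])
  have X [measurable]: "X k \<in> M \<rightarrow>\<^sub>M count_space UNIV" for k
    using mc by (simp add: markov_chain_def)
  have [measurable]: "occupation X n \<in> borel_measurable M" for n
    by (rule occupation_measurable) measurable
  define D where "D A = integral\<^sup>L (dirichlet \<theta>) (monomial A)" for A
  define s where "s = (\<Sum>l\<in>UNIV. \<theta> $ l)"
  define m where "m A j n = (\<integral>\<omega>. monomial A (occupation X n \<omega>) * of_bool (X n \<omega> = j) \<partial>M)" for A j n
  define T where "T A n = (\<integral>\<omega>. monomial A (occupation X n \<omega>) \<partial>M)" for A n
  have s: "s > 0" unfolding s_def using \<theta> by (intro sum_pos) auto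
  have D_empty: "D {#} = 1" by (simp add: D_def monomial_empty[abs_def] D.prob_space)
  have D_add: "(s + real (size A)) * D (add_mset j A) = (\<theta> $ j + real (count A j)) * D A" for A j
    unfolding D_def s_def by (rule dirichlet_moment_add[OF \<theta>])
  have T_sum: "T A n = (\<Sum>j\<in>UNIV. m A j n)" if "n > 0" for A n
  proof -
    have "integrable M (\<lambda>\<omega>. monomial A (occupation X n \<omega>) * of_bool (X n \<omega> = j))" for j
      using monomial_bounds[OF occupation_in_simplex[OF that, of X]]
      by (intro integrable_const_bound[of _ 1]) auto
    then have "(\<Sum>j\<in>UNIV. m A j n) = (\<integral>\<omega>. (\<Sum>j\<in>UNIV. monomial A (occupation X n \<omega>) * of_bool (X n \<omega> = j)) \<partial>M)"
      unfolding m_def by (subst Bochner_Integration.integral_sum) auto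
    also have "\<dots> = T A n" unfolding T_def sum_distrib_left[symmetric] by simp
    finally show ?thesis by simp
  qed
  have rec: "(\<lambda>n. (real n + 1) * (m A j (Suc n) - m A j n) + (real (size A) + s) * m A j n
    - (real (count A j) * m (A - {#j#}) j n + \<theta> $ j * T A n)) \<longlonglongrightarrow> 0" for A j
    unfolding m_def T_def s_def by (rule occupation_moment_recursion[OF mc \<theta>])
  have "T A \<longlonglongrightarrow> D A \<and> (\<forall>j. m A j \<longlonglongrightarrow> D (add_mset j A))"
  proof (induction "size A" arbitrary: A rule: less_induct)
    case less
    \<comment> \<open>The induction hypothesis at \<open>A - {#j#}\<close> with state
      \<open>j\<close> gives \<open>D (add_mset j (A - {#j#}))\<close>, which is
      \<open>D A\<close>.\<close>
    have prev: "(\<lambda>n. real (count A j) * m (A - {#j#}) j n) \<longlonglongrightarrow> real (count A j) * D A" for j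
    proof (cases "j \<in># A")
      case True
      then have "m (A - {#j#}) j \<longlonglongrightarrow> D (add_mset j (A - {#j#}))"
        using less[of "A - {#j#}"] size_Diff1_less[OF True] by blast
      then show ?thesis using True by (intro tendsto_mult_left) simp
    next
      case False
      then show ?thesis by (simp add: not_in_iff)
    qed
    have T: "T A \<longlonglongrightarrow> D A"
    proof (cases "A = {#}")
      \<comment> \<open>Here the damping constant \<open>size A\<close> would be 0, so
        \<open>recursion_tendsto\<close> does not apply; the total moment is constantly 1.\<close>
      case True
      then show ?thesis by (simp add: T_def[abs_def] D_empty prob_space)
    next
      case False
      define E where "E n = (\<Sum>j\<in>UNIV. (real n + 1) * (m A j (Suc n) - m A j n) + (real (size A) + s) * m A j n
        - (real (count A j) * m (A - {#j#}) j n + \<theta> $ j * T A n))" for n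
      define B where "B n = (\<Sum>j\<in>UNIV. real (count A j) * m (A - {#j#}) j n)" for n
      have "E \<longlonglongrightarrow> (\<Sum>j\<in>(UNIV :: 'm set). 0)" unfolding E_def by (intro tendsto_sum rec)
      moreover have "B \<longlonglongrightarrow> (\<Sum>j\<in>UNIV. real (count A j) * D A)"
        unfolding B_def by (intro tendsto_sum prev)
      ultimately have "(\<lambda>n. E n + B n) \<longlonglongrightarrow> (\<Sum>j\<in>(UNIV :: 'm set). 0) + (\<Sum>j\<in>UNIV. real (count A j) * D A)"
        by (rule tendsto_add)
      also have "(\<Sum>j\<in>(UNIV :: 'm set). 0) + (\<Sum>j\<in>UNIV. real (count A j) * D A) = real (size A) * D A"
      proof -
        have "size A = (\<Sum>j\<in>UNIV. count A j)"
          unfolding size_multiset_overloaded_eq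
          by (rule sum.mono_neutral_left) (auto simp: not_in_iff)
        then show ?thesis by (simp add: sum_distrib_right)
      qed
      finally have "(\<lambda>n. (real n + 1) * (T A (Suc n) - T A n) + real (size A) * T A n) \<longlonglongrightarrow> real (size A) * D A"
      proof (rule Lim_transform_eventually)
        show "\<forall>\<^sub>F n in sequentially. E n + B n = (real n + 1) * (T A (Suc n) - T A n) + real (size A) * T A n"
          using eventually_gt_at_top[of 0]
        proof eventually_elim
          fix n :: nat assume n: "0 < n"
          \<comment> \<open>Summed over \<open>j\<close>, the terms
            \<open>\<theta> $ j * T A n\<close> give \<open>s * T A n\<close> and cancel the damping
            by \<open>s\<close>, so only \<open>size A\<close> remains as damping constant.\<close>
          have "E n + B n = (real n + 1) * ((\<Sum>j\<in>UNIV. m A j (Suc n)) - (\<Sum>j\<in>UNIV. m A j n))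
              + (real (size A) + s) * (\<Sum>j\<in>UNIV. m A j n) - s * T A n"
            unfolding E_def B_def s_def
            by (simp add: sum.distrib sum_subtractf sum_distrib_left sum_distrib_right right_diff_distrib)
          also have "\<dots> = (real n + 1) * (T A (Suc n) - T A n) + real (size A) * T A n"
            using n by (simp add: T_sum[symmetric] distrib_right)
          finally show "E n + B n = (real n + 1) * (T A (Suc n) - T A n) + real (size A) * T A n" .
        qed
      qed
      then have "T A \<longlonglongrightarrow> (real (size A) * D A) / real (size A)"
        using False by (intro recursion_tendsto) (auto simp: nonempty_has_size)
      then show ?thesis using False by simp
    qed
    have "m A j \<longlonglongrightarrow> D (add_mset j A)" for j
    proof -
      have "(\<lambda>n. ((real n + 1) * (m A j (Suc n) - m A j n) + (real (size A) + s) * m A j n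
          - (real (count A j) * m (A - {#j#}) j n + \<theta> $ j * T A n))
          + (real (count A j) * m (A - {#j#}) j n + \<theta> $ j * T A n))
        \<longlonglongrightarrow> 0 + (real (count A j) * D A + \<theta> $ j * D A)"
        by (intro tendsto_add rec prev tendsto_mult_left T)
      then have "(\<lambda>n. (real n + 1) * (m A j (Suc n) - m A j n) + (real (size A) + s) * m A j n)
        \<longlonglongrightarrow> (s + real (size A)) * D (add_mset j A)"
        unfolding D_add by (simp add: algebra_simps)
      then have "m A j \<longlonglongrightarrow> (s + real (size A)) * D (add_mset j A) / (real (size A) + s)"
        using s by (intro recursion_tendsto) auto
      then show ?thesis using s by (simp add: add.commute)
    qed
    with T show ?case by blast
  qed
  then show ?thesis by (simp add: T_def[abs_def] D_def)
qed

lemma occupation_limit_dirichlet: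
  fixes \<theta> :: "real ^ 'm::{finite,linorder}"
  assumes \<theta>: "\<And>i. \<theta> $ i > 0"
  shows "occupation_limit (Theta \<theta>) (dirichlet \<theta>)"
  unfolding occupation_limit_def
proof (intro conjI allI impI)
  interpret D: prob_space "dirichlet \<theta>" by (rule prob_space_dirichlet[OF \<theta>])
  show "prob_space (dirichlet \<theta>)" by (rule prob_space_dirichlet[OF \<theta>])
  show full: "measure (dirichlet \<theta>) prob_simplex = 1"
    using emeasure_dirichlet_simplex[OF \<theta>] by (simp add: measure_def)
  fix \<pi> and M :: "(nat \<Rightarrow> 'm) measure" and X
  assume mc: "markov_chain M X \<pi> (trans_mat (Theta \<theta>))"
  interpret prob_space M using mc by (simp add: markov_chain_def)
  have [measurable]: "occupation X n \<in> borel_measurable M" for n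
    using mc by (intro occupation_measurable) (simp add: markov_chain_def)
  show "weakly_converges (\<lambda>n. distr M borel (occupation X n)) (dirichlet \<theta>)"
  proof (rule moments_imp_weak_convergence)
    show "prob_space (distr M borel (occupation X n))" for n by (rule prob_space_distr) measurable
    show "AE x in distr M borel (occupation X n). x \<in> prob_simplex" if "n > 0" for n
      using occupation_in_simplex[OF that] by (subst AE_distr_iff) (auto intro!: AE_I2)
    show "AE x in dirichlet \<theta>. x \<in> prob_simplex"
      using full by (subst (asm) D.prob_eq_1) auto
    show "(\<lambda>n. integral\<^sup>L (distr M borel (occupation X n)) (monomial A))
        \<longlonglongrightarrow> integral\<^sup>L (dirichlet \<theta>) (monomial A)" for A
      using occupation_moment_limit[OF mc \<theta>, of A] by (simp add: integral_distr)
  qed (auto intro: prob_space_dirichlet[OF \<theta>])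
qed simp

text \<open>One chain on the path type, started at an arbitrary state, suffices: its occupation laws
  converge weakly to both measures, which then agree on bounded continuous functions.\<close>

lemma occupation_limit_unique:
  fixes G :: "real ^ 'm::finite ^ 'm"
  assumes G: "G \<in> generators" and lim: "occupation_limit G \<mu>" "occupation_limit G \<nu>"
  shows "\<mu> = \<nu>"
proof -
  obtain M :: "(nat \<Rightarrow> 'm) measure" and X where mc: "markov_chain M X (return_pmf undefined) (trans_mat G)"
    using ex_markov_chain[of "trans_mat G"] trans_mat_stochastic[OF G] by blast
  have conv: "weakly_converges (\<lambda>n. distr M borel (occupation X n)) \<rho>" if "occupation_limit G \<rho>" for \<rho>
    using that mc by (auto simp: occupation_limit_def)
  show ?thesis
  proof (rule measure_eqI_bounded_continuous)
    fix f :: "real ^ 'm \<Rightarrow> real"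
    assume "continuous_on UNIV f" "bounded (range f)"
    then show "integral\<^sup>L \<mu> f = integral\<^sup>L \<nu> f"
      using conv[OF lim(1)] conv[OF lim(2)] unfolding weakly_converges_def
      by (blast intro: LIMSEQ_unique)
  qed (use lim in \<open>auto simp: occupation_limit_def\<close>)
qed

theorem theorem1p4:
  fixes \<theta> :: "real ^ 'm::{finite,linorder}"
  assumes "CARD('m) \<ge> 2"
    and "\<And>i. \<theta> $ i > 0"
  shows "mu (Theta \<theta>) = dirichlet \<theta>"
  unfolding mu_def
  using occupation_limit_dirichlet[OF assms(2)]
    occupation_limit_unique[OF Theta_in_generators[OF assms(2)]]
  by (blast intro: the_equality)

end
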